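(* Let $K$ be a real closed field with a compatible non-Archimedean absolute value and let $n\in\mathbb{N}$. Let $I$ be the category of linear embeddings of $\mathbb{P}^n$ described in the context, and for $\iota\in I$ let $\pi_\iota\colon \mathfrak{R}\mathcal{X}_n(K)\to \mathrm{Trop}_r(\mathbb{P}^n,\iota)$ be the evaluation map described in the context. Then the canonical map $$\varprojlim_{\iota\in I}\pi_\iota\colon\ \mathfrak{R}\mathcal{X}_n(K)\longrightarrow \varprojlim_{\iota\in I}\mathrm{Trop}_r(\mathbb{P}^n,\iota)$$ is a homeomorphism.
   Context: Standing setting: $K$ is a real closed field with a non-Archimedean absolute value $|\cdot|\colon K\to\mathbb{R}_{\ge 0}$ (possibly trivial) which is compatible with the unique ordering: $0\le a\le b$ implies $|a|\le |b|$. $\mathrm{sgn}\colon K\to\{0,+1,-1\}$ is the sign function. $\mathbb{P}^n$ denotes projective space over $K$. Signed seminorms: a signed seminorm on a finite-dimensional $K$-vector space $V$ is a map $\|\cdot\|^{\mathrm{sgn}}\colon V\to\mathbb{R}$ such that (i) $\|\lambda v\|^{\mathrm{sgn}}=\mathrm{sgn}(\lambda)|\lambda|\,\|v\|^{\mathrm{sgn}}$ for $\lambda\in K$, $v\in V$; (ii) $\min(\|v\|^{\mathrm{sgn}},\|w\|^{\mathrm{sgn}})\le\|v+w\|^{\mathrm{sgn}}\le\max(\|v\|^{\mathrm{sgn}},\|w\|^{\mathrm{sgn}})$ for $v,w\in V$. Two signed seminorms are homothetic if they differ by multiplication with a constant $c\in\mathbb{R}\setminus\{0\}$. Signed Goldman–Iwahori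 space: $\mathfrak{R}\mathcal{X}_n(K)$ is the set of not identically zero signed seminorms on the dual space $(K^{n+1})^*$ modulo homothety, with the quotient topology of the topology of pointwise convergence. Real tropicalization: $\mathrm{trop}_r\colon\mathbb{P}^m(K)\to\mathbb{RP}^m$, $(x_0:\dots:x_m)\mapsto(\mathrm{sgn}(x_0)|x_0|:\dots:\mathrm{sgn}(x_m)|x_m|)$, where $\mathbb{RP}^m$ has the Euclidean topology. A linear embedding $\iota\colon\mathbb{P}^n\hookrightarrow\mathbb{P}^m$ is given by $\iota=(f_0:\dots:f_m)$ with $f_0,\dots,f_m\in(K^{n+1})^*$ generating $(K^{n+1})^*$. If $|\cdot|$ is non-trivial, $\mathrm{Trop}_r(\mathbb{P}^n,\iota)\subseteq\mathbb{RP}^m$ is the closure of $\mathrm{trop}_r(\iota(\mathbb{P}^n(K)))$. If $|\cdot|$ is trivial, choose a non-trivially valued real closed extension $L/K$ with compatible absolute value extending that of $K$ and set $\mathrm{Trop}_r(\mathbb{P}^n,\iota):=\mathrm{Trop}_r(\mathbb{P}^n_L,\iota_L)$; this is independent of $L$. Category $I$: objects are linear embeddings $\iota\colon\mathbb{P}^n\hookrightarrow U\subseteq\mathbb{P}^m$ ($m$ varying), where $U$ is a torus-invariant open subset of $\mathbb{P}^m$ (containing the image of $\iota$). A morphism from $\iota\colon\mathbb{P}^n\hookrightarrow U$ to $\iota'\colon\mathbb{P}^n\hookrightarrow U'\subseteq\mathbb{P}^{m'}$ is a map $\varphi\colon U\to U'$ with $\varphi\circ\iota=\iota'$ which is a composition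 of a coordinate projection (forgetting some homogeneous coordinates) and a coordinate permutation. Such $\varphi$ induces, by the same coordinate projection and permutation, a continuous map $\varphi_r^{\mathrm{trop}}\colon\mathrm{Trop}_r(\mathbb{P}^n,\iota)\to\mathrm{Trop}_r(\mathbb{P}^n,\iota')$; the inverse limit is taken along these maps. Maps $\pi_\iota$: for $\iota=(f_0:\dots:f_m)$, $\pi_\iota([\|\cdot\|^{\mathrm{sgn}}])=(\|f_0\|^{\mathrm{sgn}}:\dots:\|f_m\|^{\mathrm{sgn}})$, which takes values in $\mathrm{Trop}_r(\mathbb{P}^n,\iota)$. These satisfy $\varphi_r^{\mathrm{trop}}\circ\pi_\iota=\pi_{\iota'}$ and hence induce the canonical map to the inverse limit. *)

theory Defs
  imports "HOL-Analysis.Analysis" "HOL-Library.Function_Algebras"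
begin

section \<open>Real closed fields with a compatible non-Archimedean absolute value\<close>

class real_closed_field = linordered_field +
  assumes nonneg_square: "0 \<le> x \<Longrightarrow> \<exists>y. y * y = x"
    and odd_degree_root: "odd n \<Longrightarrow> c n \<noteq> 0 \<Longrightarrow> \<exists>x. (\<Sum>k\<le>n. c k * x ^ k) = 0"

definition compatible_nonarch_abs :: "('k::linordered_field \<Rightarrow> real) \<Rightarrow> bool" where
  "compatible_nonarch_abs v \<longleftrightarrow>
     (\<forall>x. 0 \<le> v x) \<and> (\<forall>x. v x = 0 \<longleftrightarrow> x = 0) \<and>
     (\<forall>x y. v (x * y) = v x * v y) \<and>
     (\<forall>x y. v (x + y) \<le> max (v x) (v y)) \<and>
     (\<forall>a b. 0 \<le> a \<and> a \<le> b \<longrightarrow> v a \<le> v b)"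

definition trivial_abs :: "('k::field \<Rightarrow> real) \<Rightarrow> bool" where
  "trivial_abs v \<longleftrightarrow> (\<forall>x. x \<noteq> 0 \<longrightarrow> v x = 1)"

definition valued_extension ::
    "('k::field \<Rightarrow> real) \<Rightarrow> ('l::field \<Rightarrow> real) \<Rightarrow> ('k \<Rightarrow> 'l) \<Rightarrow> bool" where
  "valued_extension v w h \<longleftrightarrow>
     h 1 = 1 \<and> (\<forall>x y. h (x + y) = h x + h y) \<and> (\<forall>x y. h (x * y) = h x * h y) \<and>
     (\<forall>x. w (h x) = v x)"

definition real_sgn :: "'k::linordered_field \<Rightarrow> real" where
  "real_sgn x = (if x = 0 then 0 else if 0 < x then 1 else - 1)"

definition signed_abs :: "('k::linordered_field \<Rightarrow> real) \<Rightarrow> 'k \<Rightarrow> real" where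
  "signed_abs v x = real_sgn x * v x"


section \<open>Quotient topologies and projectivization\<close>

definition quotient_topology :: "'a topology \<Rightarrow> ('a \<Rightarrow> 'b) \<Rightarrow> 'b topology" where
  "quotient_topology X q =
     topology (\<lambda>U. U \<subseteq> q ` topspace X \<and> openin X {x \<in> topspace X. q x \<in> U})"

lemma openin_quotient_topology:
  "openin (quotient_topology X q) U \<longleftrightarrow>
     U \<subseteq> q ` topspace X \<and> openin X {x \<in> topspace X. q x \<in> U}"
proof -
  let ?P = "\<lambda>U. U \<subseteq> q ` topspace X \<and> openin X {x \<in> topspace X. q x \<in> U}"
  have "istopology ?P"
    unfolding istopology_def
  proof (intro conjI allI impI)
    fix S T assume S: "?P S" and T: "?P T"
    have "{x \<in> topspace X. q x \<in> S \<inter> T} =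
        {x \<in> topspace X. q x \<in> S} \<inter> {x \<in> topspace X. q x \<in> T}"
      by blast
    moreover have "openin X ({x \<in> topspace X. q x \<in> S} \<inter> {x \<in> topspace X. q x \<in> T})"
      using S T by (intro openin_Int) (rule conjunct2, assumption)+
    ultimately show "openin X {x \<in> topspace X. q x \<in> S \<inter> T}"
      by (simp only:)
    show "S \<inter> T \<subseteq> q ` topspace X"
      using S by blast
  next
    fix \<K> assume K: "\<forall>K\<in>\<K>. ?P K"
    have "{x \<in> topspace X. q x \<in> \<Union>\<K>} = (\<Union>K\<in>\<K>. {x \<in> topspace X. q x \<in> K})"
      by blast
    moreover have "openin X (\<Union>K\<in>\<K>. {x \<in> topspace X. q x \<in> K})"
      using K by (intro openin_Union) blast
    ultimately show "openin X {x \<in> topspace X. q x \<in> \<Union>\<K>}"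
      by (simp only:)
    show "\<Union>\<K> \<subseteq> q ` topspace X"
      using K by blast
  qed
  then show ?thesis
    unfolding quotient_topology_def by (subst topology_inverse') simp_all
qed

lemma topspace_quotient_topology [simp]: "topspace (quotient_topology X q) = q ` topspace X"
proof (rule antisym)
  show "topspace (quotient_topology X q) \<subseteq> q ` topspace X"
    using openin_topspace[of "quotient_topology X q"]
    unfolding openin_quotient_topology by (rule conjunct1)
  have "{x \<in> topspace X. q x \<in> q ` topspace X} = topspace X"
    by blast
  then have "openin (quotient_topology X q) (q ` topspace X)"
    unfolding openin_quotient_topology by simp
  then show "q ` topspace X \<subseteq> topspace (quotient_topology X q)"
    by (rule openin_subset)
qed

lemma quotient_map_quotient_topology: "quotient_map X (quotient_topology X q) q"
  by (simp add: quotient_map_def openin_quotient_topology)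

text \<open>
  The class of a vector modulo nonzero scalars. Points of projective spaces, linear embeddings
  and homothety classes of seminorms are all such classes; maps between them are given below by
  taking images of (all representatives of) classes, so no representatives are chosen.
\<close>

definition scalar_class :: "('c::zero \<Rightarrow> 'b \<Rightarrow> 'b) \<Rightarrow> 'b \<Rightarrow> 'b set" where
  "scalar_class s v = {s c v |c. c \<noteq> 0}"

definition projectivization :: "('c::zero \<Rightarrow> 'b::zero \<Rightarrow> 'b) \<Rightarrow> 'b set \<Rightarrow> 'b set set" where
  "projectivization s V = scalar_class s ` (V - {0})"

definition pointwise_scale :: "'a::times \<Rightarrow> ('i \<Rightarrow> 'a) \<Rightarrow> 'i \<Rightarrow> 'a" where
  "pointwise_scale c v = (\<lambda>i. c * v i)"

text \<open>
  As in \<^const>\<open>Euclidean_space\<close>, the space of tuples \<open>(x\<^sub>0, \<dots>, x\<^sub>m)\<close> is rendered as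
  the functions on \<^typ>\<open>nat\<close> vanishing beyond \<open>m\<close>.
\<close>

definition tuples :: "nat \<Rightarrow> (nat \<Rightarrow> 'a::zero) set" where
  "tuples m = {x. \<forall>i>m. x i = 0}"

abbreviation proj_space :: "nat \<Rightarrow> (nat \<Rightarrow> 'k::field) set set" where
  "proj_space m \<equiv> projectivization pointwise_scale (tuples m)"

abbreviation vec_proj_space :: "('k::field ^ 'n) set set" where
  "vec_proj_space \<equiv> projectivization (*s) UNIV"

definition RP_topology :: "nat \<Rightarrow> (nat \<Rightarrow> real) set topology" where
  "RP_topology m =
     quotient_topology (subtopology (Euclidean_space (Suc m)) (- {0}))
       (scalar_class pointwise_scale)"


section \<open>The dual space\<close>

typedef (overloaded) ('k, 'n) dual =
  "{f :: 'k::field ^ 'n::finite \<Rightarrow> 'k. Vector_Spaces.linear (*s) (*) f}"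
  morphisms dual_apply Abs_dual
proof -
  have "Vector_Spaces.linear (*s) (*) (\<lambda>x :: 'k ^ 'n. 0 :: 'k)"
    by (unfold_locales) (simp_all add: algebra_simps)
  then show ?thesis by blast
qed

setup_lifting type_definition_dual

lemma linear_functional_iff:
  fixes f :: "'k::field ^ 'n \<Rightarrow> 'k"
  shows "Vector_Spaces.linear (*s) (*) f \<longleftrightarrow>
    (\<forall>x y. f (x + y) = f x + f y) \<and> (\<forall>c x. f (c *s x) = c * f x)"
proof -
  have "vector_space ((*) :: 'k \<Rightarrow> 'k \<Rightarrow> 'k)"
    by unfold_locales (simp_all add: algebra_simps)
  moreover have "vector_space ((*s) :: 'k \<Rightarrow> 'k ^ 'n \<Rightarrow> 'k ^ 'n)" ..
  ultimately show ?thesis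
    unfolding Vector_Spaces.linear_def module_hom_def module_hom_axioms_def
      module_iff_vector_space by simp
qed

instantiation dual :: (field, finite) ab_group_add
begin

lift_definition zero_dual :: "('a, 'b) dual" is "\<lambda>x. 0"
  by (simp add: linear_functional_iff)

lift_definition plus_dual :: "('a, 'b) dual \<Rightarrow> ('a, 'b) dual \<Rightarrow> ('a, 'b) dual"
  is "\<lambda>f g x. f x + g x"
  by (simp add: linear_functional_iff algebra_simps)

lift_definition uminus_dual :: "('a, 'b) dual \<Rightarrow> ('a, 'b) dual" is "\<lambda>f x. - f x"
  by (simp add: linear_functional_iff)

lift_definition minus_dual :: "('a, 'b) dual \<Rightarrow> ('a, 'b) dual \<Rightarrow> ('a, 'b) dual"
  is "\<lambda>f g x. f x - g x"
  by (simp add: linear_functional_iff algebra_simps)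

instance
  by standard (transfer; simp add: algebra_simps fun_eq_iff)+

end

lift_definition dual_scale :: "'k::field \<Rightarrow> ('k, 'n::finite) dual \<Rightarrow> ('k, 'n) dual"
  is "\<lambda>c f x. c * f x"
  by (simp add: linear_functional_iff algebra_simps)

interpretation dual: vector_space "dual_scale :: 'k::field \<Rightarrow> ('k, 'n::finite) dual \<Rightarrow> ('k, 'n) dual"
  by unfold_locales (transfer; simp add: algebra_simps)+

text \<open>Base change along \<open>h\<close>: the functional with coefficients \<open>h (f e\<^sub>i)\<close>.\<close>

lift_definition dual_base_change ::
    "('k::field \<Rightarrow> 'l::field) \<Rightarrow> ('k, 'n::finite) dual \<Rightarrow> ('l, 'n) dual"
  is "\<lambda>h f x. \<Sum>i\<in>UNIV. h (f (axis i 1)) * x $ i"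
  by (simp add: linear_functional_iff algebra_simps sum.distrib sum_distrib_left)


section \<open>Signed seminorms and the signed Goldman--Iwahori space\<close>

definition signed_seminorm ::
    "('k::linordered_field \<Rightarrow> real) \<Rightarrow> ('k \<Rightarrow> 'b \<Rightarrow> 'b) \<Rightarrow> ('b::ab_group_add \<Rightarrow> real) \<Rightarrow> bool" where
  "signed_seminorm v s N \<longleftrightarrow>
     (\<forall>c x. N (s c x) = real_sgn c * v c * N x) \<and>
     (\<forall>x y. min (N x) (N y) \<le> N (x + y) \<and> N (x + y) \<le> max (N x) (N y))"

definition signed_GI_space ::
    "('k::linordered_field \<Rightarrow> real) \<Rightarrow> (('k, 'n::finite) dual \<Rightarrow> real) set topology" where
  "signed_GI_space v =
     quotient_topology
       (subtopology (powertop_real UNIV) {N. signed_seminorm v dual_scale N \<and> N \<noteq> 0})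
       (scalar_class pointwise_scale)"


section \<open>Linear embeddings\<close>

text \<open>
  A linear embedding \<open>(f\<^sub>0 : \<dots> : f\<^sub>m)\<close> is represented by the class of the tuple
  \<open>(f\<^sub>0, \<dots>, f\<^sub>m)\<close> of functionals modulo a common scalar.
\<close>

definition linear_embeddings :: "nat \<Rightarrow> (nat \<Rightarrow> ('k::field, 'n::finite) dual) set set" where
  "linear_embeddings m =
     scalar_class (\<lambda>c f i. dual_scale c (f i)) `
       {f \<in> tuples m. dual.span (f ` {..m}) = UNIV}"

definition emb_map ::
    "(nat \<Rightarrow> ('k::field, 'n::finite) dual) set \<Rightarrow> ('k ^ 'n) set \<Rightarrow> (nat \<Rightarrow> 'k) set" where
  "emb_map \<iota> p = {(\<lambda>i. dual_apply (f i) x) |f x. f \<in> \<iota> \<and> x \<in> p}"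

definition emb_base_change ::
    "('k::field \<Rightarrow> 'l::field) \<Rightarrow> (nat \<Rightarrow> ('k, 'n::finite) dual) set \<Rightarrow> (nat \<Rightarrow> ('l, 'n) dual) set" where
  "emb_base_change h \<iota> = {(\<lambda>i. dual_scale c (dual_base_change h (f i))) |c f. c \<noteq> 0 \<and> f \<in> \<iota>}"


section \<open>Real tropicalization\<close>

text \<open>
  The real scalar \<open>c\<close> is needed to obtain a full class: rescaling representatives of \<open>p\<close> only
  rescales the signed absolute values by elements of the signed value group.
\<close>

definition trop_r ::
    "('k::linordered_field \<Rightarrow> real) \<Rightarrow> (nat \<Rightarrow> 'k) set \<Rightarrow> (nat \<Rightarrow> real) set" where
  "trop_r v p = {(\<lambda>i. c * signed_abs v (x i)) |c x. c \<noteq> 0 \<and> x \<in> p}"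

text \<open>The data \<open>w\<close>, \<open>h\<close> of an extension field is only used if \<open>v\<close> is trivial.\<close>

definition Trop_r ::
    "('k::linordered_field \<Rightarrow> real) \<Rightarrow> ('l::linordered_field \<Rightarrow> real) \<Rightarrow> ('k \<Rightarrow> 'l) \<Rightarrow>
     nat \<Rightarrow> (nat \<Rightarrow> ('k, 'n::finite) dual) set \<Rightarrow> (nat \<Rightarrow> real) set set" where
  "Trop_r v w h m \<iota> =
     (if trivial_abs v
      then RP_topology m closure_of (trop_r w ` emb_map (emb_base_change h \<iota>) ` vec_proj_space)
      else RP_topology m closure_of (trop_r v ` emb_map \<iota> ` vec_proj_space))"


section \<open>The category of linear embeddings\<close>

definition homogeneous_form :: "nat \<Rightarrow> ((nat \<Rightarrow> 'k::field) \<Rightarrow> 'k) \<Rightarrow> bool" where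
  "homogeneous_form m F \<longleftrightarrow>
     (\<exists>d A c. finite A \<and> (\<forall>\<alpha>\<in>A. (\<Sum>i\<le>m. \<alpha> i) = d) \<and>
        F = (\<lambda>x. \<Sum>\<alpha>\<in>A. c \<alpha> * (\<Prod>i\<le>m. x i ^ (\<alpha> i :: nat))))"

definition zariski_open :: "nat \<Rightarrow> (nat \<Rightarrow> 'k::field) set set \<Rightarrow> bool" where
  "zariski_open m U \<longleftrightarrow>
     (\<exists>S. (\<forall>F\<in>S. homogeneous_form m F) \<and>
        U = {p \<in> proj_space m. \<exists>F\<in>S. \<exists>x\<in>p. F x \<noteq> 0})"

definition torus_invariant :: "nat \<Rightarrow> (nat \<Rightarrow> 'k::field) set set \<Rightarrow> bool" where
  "torus_invariant m U \<longleftrightarrow>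
     (\<forall>t. (\<forall>i\<le>m. t i \<noteq> 0) \<longrightarrow> (\<forall>p\<in>U. (\<lambda>x i. t i * x i) ` p \<in> U))"

text \<open>
  An open set \<open>U\<close> is represented by its set of rational points. A torus-invariant open set is a
  union of torus orbits, each of which has a rational point, so this loses no information, and
  containment of images in \<open>U\<close> can be tested on rational points.
\<close>

record (overloaded) ('k, 'n) embedding =
  ambient_dim :: nat
  emb :: "(nat \<Rightarrow> ('k, 'n) dual) set"
  nbhd :: "(nat \<Rightarrow> 'k) set set"

definition objects :: "('k::field, 'n::finite) embedding set" where
  "objects = {X. emb X \<in> linear_embeddings (ambient_dim X) \<and>
     zariski_open (ambient_dim X) (nbhd X) \<and> torus_invariant (ambient_dim X) (nbhd X) \<and>
     emb_map (emb X) ` vec_proj_space \<subseteq> nbhd X}"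

text \<open>
  \<open>coord_map m' \<sigma>\<close> is \<open>(x\<^sub>0 : \<dots> : x\<^sub>m) \<mapsto> (x\<^bsub>\<sigma> 0\<^esub> : \<dots> : x\<^bsub>\<sigma> m'\<^esub>)\<close>. The compositions of coordinate
  projections and permutations are these maps for injective \<open>\<sigma>\<close>. At a point where all chosen
  coordinates vanish the value is \<open>{0}\<close>, which is not a point of projective space; hence the
  inclusion of images in \<open>is_morphism\<close> says in particular that the map is defined on \<open>nbhd X\<close>.
\<close>

definition coord_map :: "nat \<Rightarrow> (nat \<Rightarrow> nat) \<Rightarrow> (nat \<Rightarrow> 'a::zero) set \<Rightarrow> (nat \<Rightarrow> 'a) set" where
  "coord_map m' \<sigma> p = (\<lambda>x j. if j \<le> m' then x (\<sigma> j) else 0) ` p"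

definition is_morphism ::
    "(nat \<Rightarrow> nat) \<Rightarrow> ('k::field, 'n::finite) embedding \<Rightarrow> ('k, 'n) embedding \<Rightarrow> bool" where
  "is_morphism \<sigma> X Y \<longleftrightarrow>
     inj_on \<sigma> {..ambient_dim Y} \<and> \<sigma> ` {..ambient_dim Y} \<subseteq> {..ambient_dim X} \<and>
     coord_map (ambient_dim Y) \<sigma> ` nbhd X \<subseteq> nbhd Y \<and>
     (\<forall>p\<in>vec_proj_space. coord_map (ambient_dim Y) \<sigma> (emb_map (emb X) p) = emb_map (emb Y) p)"

definition Trop_limit ::
    "('k::linordered_field \<Rightarrow> real) \<Rightarrow> ('l::linordered_field \<Rightarrow> real) \<Rightarrow> ('k \<Rightarrow> 'l) \<Rightarrow>
     (('k, 'n::finite) embedding \<Rightarrow> (nat \<Rightarrow> real) set) topology" where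
  "Trop_limit v w h =
     subtopology
       (product_topology
         (\<lambda>X. subtopology (RP_topology (ambient_dim X)) (Trop_r v w h (ambient_dim X) (emb X)))
         objects)
       {z. \<forall>X\<in>objects. \<forall>Y\<in>objects. \<forall>\<sigma>.
          is_morphism \<sigma> X Y \<longrightarrow> coord_map (ambient_dim Y) \<sigma> (z X) = z Y}"

definition evaluation ::
    "(nat \<Rightarrow> ('k, 'n) dual) set \<Rightarrow> (('k::field, 'n::finite) dual \<Rightarrow> real) set \<Rightarrow>
     (nat \<Rightarrow> real) set" where
  "evaluation \<iota> \<xi> = {(\<lambda>i. N (f i)) |f N. f \<in> \<iota> \<and> N \<in> \<xi>}"

definition canonical_map ::
    "(('k::field, 'n::finite) dual \<Rightarrow> real) set \<Rightarrow> ('k, 'n) embedding \<Rightarrow> (nat \<Rightarrow> real) set" where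
  "canonical_map \<xi> = (\<lambda>X\<in>objects. evaluation (emb X) \<xi>)"

end

theory Submission
  imports Defs
begin

text \<open>
  The theorem rests on two facts. The first is that evaluation at finitely many functionals
  sends a signed seminorm into the real tropicalization, that is, every signed seminorm is on a
  finite set of functionals a limit of the seminorms \<open>f \<mapsto> signed_abs v (f x)\<close> given by points \<open>x\<close>
  (\<open>trop_points_approximate\<close>). The second is that a point of the limit is the same as a
  compatible assignment of a value to each functional, and that the axioms of a signed seminorm
  can be read off from its coordinates.

  Approximation over a non-trivially valued \<open>K\<close> is linear programming. The signed absolute
  values are dense in the reals, so for each \<open>f\<close> there are \<open>a\<^sub>f\<close>, \<open>b\<^sub>f\<close> in \<open>K\<close> whose signed absolute
  values lie just below and just above \<open>N f\<close>, and by monotonicity any \<open>x\<close> with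
  \<open>a\<^sub>f < f x < b\<^sub>f\<close> for all \<open>f\<close> will do. Fourier--Motzkin elimination (\<open>separating_vector\<close>)
  solves this system unless a positive combination of the pairs \<open>(f, - a\<^sub>f)\<close>, \<open>(- f, b\<^sub>f)\<close> and
  \<open>(0, 1)\<close> vanishes. It cannot vanish: all these pairs \<open>(g, c)\<close> satisfy
  \<open>0 < N g + signed_abs v c\<close>, and this condition is stable under sums and positive scaling
  (\<open>positive_sum_add\<close>). If \<open>v\<close> is trivial, \<open>N\<close> is a flag of subspaces with an ordering on each
  graded piece, and only finitely many absolute values \<open>r\<close> occur. For each \<open>r\<close> the same
  elimination yields a vector \<open>x\<^sub>r\<close> over \<open>K\<close> that has the prescribed sign on the functionals of
  value \<open>r\<close> or \<open>- r\<close> and is annihilated by the smaller ones; the approximating point is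
  \<open>\<Sum>r. t\<^sub>r x\<^sub>r\<close> with \<open>t\<^sub>r\<close> in the extension field of absolute value slightly below \<open>r\<close>.

  For the second fact, two embeddings have a common refinement, the concatenation of their tuples
  restricted to the open set where both projections are defined (\<open>join_object\<close>). Hence the
  coordinates of a point of the limit at a functional \<open>f\<close> agree in all embeddings that contain
  \<open>f\<close>, after a common rescaling (\<open>limit_common_coordinates\<close>). Fix a finite spanning list \<open>bs\<close>.
  Some coordinate at a member \<open>b\<close> of \<open>bs\<close> is nonzero; rescaling it to 1 gives a function \<open>N\<close> on
  the dual space. Each axiom of a signed seminorm is a closed scaling-invariant condition on the
  coordinates at two or three functionals and holds at the points of a projective space, so it
  persists in the closure, and \<open>N\<close> is a signed seminorm (\<open>normalized_seminorm_is_seminorm\<close>) whose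
  image is the given point (\<open>canonical_map_normalized\<close>). Every value of \<open>N\<close> is a quotient of two
  coordinates, so the inverse is continuous on the open set where the coordinate at \<open>b\<close> does not
  vanish, and these sets cover the limit.
\<close>

section \<open>Signed seminorms\<close>

locale signed_seminormed = vector_space scale
  for scale :: "'k::linordered_field \<Rightarrow> 'b::ab_group_add \<Rightarrow> 'b" +
  fixes v :: "'k \<Rightarrow> real" and N :: "'b \<Rightarrow> real"
  assumes compatible: "compatible_nonarch_abs v"
    and seminorm: "signed_seminorm v scale N"
begin

lemma zero [simp]: "N 0 = 0"
proof -
  have "N (scale 0 0) = real_sgn (0 :: 'k) * v 0 * N 0"
    using seminorm unfolding signed_seminorm_def by blast
  then show ?thesis by (simp add: real_sgn_def)
qed

lemma scale_pos: "0 < c \<Longrightarrow> N (scale c x) = v c * N x"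
  using seminorm unfolding signed_seminorm_def by (auto simp: real_sgn_def)

lemma abs_one: "v 1 = 1"
  using compatible unfolding compatible_nonarch_abs_def
  by (metis mult_cancel_left1 mult.right_neutral zero_neq_one)

lemma abs_pos: "c \<noteq> 0 \<Longrightarrow> 0 < v c"
  using compatible unfolding compatible_nonarch_abs_def by (metis order_less_le)

lemma abs_minus: "v (- c) = v c"
proof -
  have "v (-1) * v (-1) = 1" "0 \<le> v (-1)"
    using compatible abs_one unfolding compatible_nonarch_abs_def
    by (metis minus_mult_minus mult.right_neutral) (use compatible in \<open>simp add: compatible_nonarch_abs_def\<close>)
  then have "v (-1) = 1" by (metis abs_of_nonneg abs_square_eq_1 power2_eq_square)
  then show ?thesis using compatible unfolding compatible_nonarch_abs_def
    by (metis mult_minus1 mult_1)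
qed

lemma minus [simp]: "N (- x) = - N x"
proof -
  have "N (scale (-1) x) = real_sgn (-1 :: 'k) * v (-1) * N x"
    using seminorm unfolding signed_seminorm_def by blast
  then show ?thesis by (simp add: real_sgn_def abs_minus abs_one)
qed

lemma abs_scale: "\<bar>N (scale c x)\<bar> = v c * \<bar>N x\<bar>"
proof -
  have "N (scale c x) = real_sgn c * v c * N x"
    using seminorm unfolding signed_seminorm_def by blast
  moreover have "0 \<le> v c" "c = 0 \<longrightarrow> v c = 0"
    using compatible unfolding compatible_nonarch_abs_def by blast+
  ultimately show ?thesis by (auto simp: real_sgn_def abs_mult)
qed

lemma add_lower: "min (N x) (N y) \<le> N (x + y)" and add_upper: "N (x + y) \<le> max (N x) (N y)"
  using seminorm unfolding signed_seminorm_def by blast+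

text \<open>
  On elements of nonnegative value the ultrametric inequality is an equality: subtracting \<open>y\<close> from
  \<open>x + y\<close> bounds \<open>N x\<close> by the maximum of \<open>N (x + y)\<close> and \<open>- N y \<le> 0\<close>.
\<close>
lemma add_nonneg:
  assumes "0 \<le> N x" "0 \<le> N y"
  shows "N (x + y) = max (N x) (N y)"
  using assms add_lower[of x y] add_upper[of x y] add_upper[of "x + y" "- x"]
      add_upper[of "x + y" "- y"]
  by (simp add: min_def max_def split: if_splits)

lemma abs_add: "\<bar>N (x + y)\<bar> \<le> max \<bar>N x\<bar> \<bar>N y\<bar>"
  using add_lower[of x y] add_upper[of x y] by linarith

lemma add_dominant:
  assumes "\<bar>N y\<bar> < \<bar>N x\<bar>"
  shows "N (x + y) = N x"
  using assms add_lower[of x y] add_upper[of x y] add_upper[of "x + y" "- y"]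
      add_lower[of "x + y" "- y"]
  by (auto simp: min_def max_def abs_if split: if_splits)

lemma abs_sum_less:
  assumes "finite A" "\<And>i. i \<in> A \<Longrightarrow> \<bar>N (g i)\<bar> < r" "0 < r"
  shows "\<bar>N (sum g A)\<bar> < r"
  using assms
proof (induction A rule: finite_induct)
  case (insert i A)
  then have "\<bar>N (sum g A)\<bar> < r" "\<bar>N (g i)\<bar> < r" by blast+
  then show ?case using insert.hyps abs_add[of "g i" "sum g A"] by simp
qed simp

end

text \<open>
  The field itself, with its signed absolute value, is the basic signed seminorm; compatibility with
  the order makes it monotone, and this gives both bounds for a sum of opposite signs.
\<close>
lemma signed_abs_facts:
  fixes v :: "'k::linordered_field \<Rightarrow> real"
  assumes v: "compatible_nonarch_abs v"
  shows signed_abs_seminorm: "signed_seminorm v (*) (signed_abs v)"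
    and signed_abs_mono: "\<And>a b. a \<le> b \<Longrightarrow> signed_abs v a \<le> signed_abs v b"
    and signed_abs_one: "signed_abs v 1 = 1"
    and signed_abs_zero: "signed_abs v 0 = 0"
    and signed_abs_eq_zero_iff: "\<And>a. signed_abs v a = 0 \<longleftrightarrow> a = 0"
    and signed_abs_of_nonneg: "\<And>a. 0 \<le> a \<Longrightarrow> signed_abs v a = v a"
    and signed_abs_mult: "\<And>a b. signed_abs v (a * b) = signed_abs v a * signed_abs v b"
    and abs_signed_abs: "\<And>a. \<bar>signed_abs v a\<bar> = v a"
    and signed_abs_minus: "\<And>a. signed_abs v (- a) = - signed_abs v a"
proof -
  have v0: "\<And>x. 0 \<le> v x" and v00: "\<And>x. v x = 0 \<longleftrightarrow> x = 0"
    and vm: "\<And>x y. v (x * y) = v x * v y" and va: "\<And>x y. v (x + y) \<le> max (v x) (v y)"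
    and vo: "\<And>a b. 0 \<le> a \<Longrightarrow> a \<le> b \<Longrightarrow> v a \<le> v b"
    using v unfolding compatible_nonarch_abs_def by blast+
  have one: "v 1 = 1" using vm[of 1 1] v00[of 1] by simp
  have "v (-1) * v (-1) = 1" using vm[of "-1" "-1"] one by simp
  then have m1: "v (-1) = 1" using v0[of "-1"]
    by (metis abs_of_nonneg abs_square_eq_1 power2_eq_square)
  have vn: "v (- x) = v x" for x using vm[of "-1" x] m1 by simp
  show mono: "signed_abs v a \<le> signed_abs v b" if "a \<le> b" for a b
    using that vo[of a b] vo[of "-b" "-a"] vn[of a] vn[of b] v0[of a] v0[of b]
    by (auto simp: signed_abs_def real_sgn_def)
  show "signed_abs v 1 = 1" "signed_abs v 0 = 0"
    by (auto simp: signed_abs_def real_sgn_def one)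
  show "signed_abs v a = 0 \<longleftrightarrow> a = 0" for a
    by (auto simp: signed_abs_def real_sgn_def v00)
  show sp: "signed_abs v a = v a" if "0 \<le> a" for a
    using that v00[of a] by (auto simp: signed_abs_def real_sgn_def)
  show "\<bar>signed_abs v a\<bar> = v a" for a
    using v00[of a] v0[of a] by (auto simp: signed_abs_def real_sgn_def)
  show sm: "signed_abs v (a * b) = signed_abs v a * signed_abs v b" for a b
    using vm[of a b] by (auto simp: signed_abs_def real_sgn_def mult_less_0_iff zero_less_mult_iff)
  show sn: "signed_abs v (- a) = - signed_abs v a" for a
    by (auto simp: signed_abs_def real_sgn_def vn)
  have key: "min (signed_abs v x) (signed_abs v y) \<le> signed_abs v (x + y) \<and>
      signed_abs v (x + y) \<le> max (signed_abs v x) (signed_abs v y)" if le: "x \<le> y" for x y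
  proof -
    consider "0 \<le> x" "0 \<le> y" | "x \<le> 0" "0 \<le> y" | "x \<le> 0" "y \<le> 0"
      using le by (meson linear order_trans)
    then show ?thesis
    proof cases
      case 1
      then have "signed_abs v x \<le> signed_abs v (x + y)"
          "signed_abs v (x + y) \<le> max (signed_abs v x) (signed_abs v y)"
        using mono[of x "x + y"] va[of x y] by (simp_all add: sp)
      then show ?thesis by linarith
    next
      case 2
      then have "signed_abs v x \<le> signed_abs v (x + y)" "signed_abs v (x + y) \<le> signed_abs v y"
        using mono[of x "x + y"] mono[of "x + y" y] by simp_all
      then show ?thesis by linarith
    next
      case 3
      have "signed_abs v (x + y) \<le> signed_abs v y" using 3 mono[of "x + y" y] by simp
      moreover have "- signed_abs v (x + y) \<le> max (- signed_abs v x) (- signed_abs v y)"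
        using 3 va[of "-x" "-y"] sp[of "-x"] sp[of "-y"] sp[of "- x - y"] sn[of x] sn[of y]
            sn[of "x + y"] by simp
      ultimately show ?thesis by linarith
    qed
  qed
  show "signed_seminorm v (*) (signed_abs v)"
    unfolding signed_seminorm_def
  proof (intro conjI allI)
    fix c x y :: 'k
    show "signed_abs v (c * x) = real_sgn c * v c * signed_abs v x"
      using sm[of c x] by (simp add: signed_abs_def)
    show "min (signed_abs v x) (signed_abs v y) \<le> signed_abs v (x + y)"
      using key[of x y] key[of y x] linear[of x y] by (auto simp: add.commute min.commute)
    show "signed_abs v (x + y) \<le> max (signed_abs v x) (signed_abs v y)"
      using key[of x y] key[of y x] linear[of x y] by (auto simp: add.commute max.commute)
  qed
qed

lemma signed_seminormed_signed_abs:
  "compatible_nonarch_abs v \<Longrightarrow> signed_seminormed (*) v (signed_abs v)"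
  by (intro signed_seminormed.intro signed_seminormed_axioms.intro signed_abs_seminorm
        vector_space_over_itself.vector_space_axioms)

section \<open>Separation by Fourier--Motzkin elimination\<close>

text \<open>
  A theorem of the alternative. Coordinates are eliminated one at a time while \<open>P\<close> stays fixed: every
  combination that arises is again in \<open>P\<close>, so the eliminated system can never contain the zero
  vector. The vectors in \<open>E\<close> are equations; shifting by multiples of them preserves \<open>P\<close>.
\<close>
lemma separating_vector:
  fixes P :: "('i \<Rightarrow> 'k::linordered_field) set"
  assumes "finite I"
    and add: "\<And>x y. x \<in> P \<Longrightarrow> y \<in> P \<Longrightarrow> (\<lambda>i. x i + y i) \<in> P"
    and scale: "\<And>c x. 0 < c \<Longrightarrow> x \<in> P \<Longrightarrow> (\<lambda>i. c * x i) \<in> P"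
    and zero: "(\<lambda>i. 0) \<notin> P"
    and "finite S" "S \<subseteq> P" "\<And>u i. u \<in> S \<union> E \<Longrightarrow> i \<notin> I \<Longrightarrow> u i = 0"
    and "finite E" "\<And>e c x. e \<in> E \<Longrightarrow> x \<in> P \<Longrightarrow> (\<lambda>i. x i + c * e i) \<in> P"
  obtains y where "\<And>u. u \<in> S \<Longrightarrow> 0 < (\<Sum>i\<in>I. u i * y i)" "\<And>e. e \<in> E \<Longrightarrow> (\<Sum>i\<in>I. e i * y i) = 0"
proof -
  have "\<exists>y. (\<forall>u\<in>S. 0 < (\<Sum>i\<in>I. u i * y i)) \<and> (\<forall>e\<in>E. (\<Sum>i\<in>I. e i * y i) = 0)"
    using assms(1,5-)
  proof (induction I arbitrary: S E rule: finite_induct)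
    case empty
    have "S = {}"
    proof (rule ccontr)
      assume "S \<noteq> {}"
      then obtain u where "u \<in> S" by blast
      moreover from this have "u = (\<lambda>i. 0)" using empty.prems(3) by blast
      ultimately show False using empty.prems(2) zero by blast
    qed
    then show ?case by simp
  next
    case (insert j I)
    show ?case
    proof (cases "\<exists>e\<in>E. e j \<noteq> 0")
      case True
      then obtain e where e: "e \<in> E" "e j \<noteq> 0" by blast
      \<comment> \<open>Gaussian elimination of the coordinate \<open>j\<close> with pivot \<open>e\<close>; the equation \<open>e\<close> then determines the
        \<open>j\<close>-th coordinate of the solution.\<close>
      define r where "r u = (\<lambda>i. u i + (- u j / e j) * e i)" for u
      have "\<exists>y. (\<forall>u\<in>r ` S. 0 < (\<Sum>i\<in>I. u i * y i)) \<and> (\<forall>u\<in>r ` E. (\<Sum>i\<in>I. u i * y i) = 0)"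
      proof (rule insert.IH)
        show "r ` S \<subseteq> P"
          using insert.prems(2) insert.prems(5)[OF e(1)] unfolding r_def by blast
        show "u i = 0" if "u \<in> r ` S \<union> r ` E" "i \<notin> I" for u i
          using that insert.prems(3)[of _ i] e insert.prems(3)[of e i]
          by (cases "i = j") (fastforce simp: r_def)+
        show "(\<lambda>i. x i + c * d i) \<in> P" if "d \<in> r ` E" "x \<in> P" for d c x
        proof -
          obtain d' where d: "d' \<in> E" "d = r d'" using \<open>d \<in> r ` E\<close> by blast
          have "(\<lambda>i. (x i + c * d' i) + (c * (- d' j / e j)) * e i) \<in> P"
            by (rule insert.prems(5)[OF e(1) insert.prems(5)[OF d(1) that(2)]])
          then show ?thesis by (simp add: d(2) r_def algebra_simps)
        qed
      qed (use insert.prems in auto)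
      then obtain y where y: "\<And>u. u \<in> S \<Longrightarrow> 0 < (\<Sum>i\<in>I. r u i * y i)"
          "\<And>u. u \<in> E \<Longrightarrow> (\<Sum>i\<in>I. r u i * y i) = 0"
        by blast
      define z where "z = y(j := - (\<Sum>i\<in>I. e i * y i) / e j)"
      have eq: "(\<Sum>i\<in>insert j I. u i * z i) = (\<Sum>i\<in>I. r u i * y i)" for u
      proof -
        have "(\<Sum>i\<in>I. u i * z i) = (\<Sum>i\<in>I. u i * y i)"
          using insert.hyps(2) by (intro sum.cong) (auto simp: z_def)
        moreover have "(\<Sum>i\<in>I. r u i * y i) = (\<Sum>i\<in>I. u i * y i) + (- u j / e j) * (\<Sum>i\<in>I. e i * y i)"
          by (simp add: r_def sum.distrib sum_distrib_left algebra_simps sum_subtractf sum_negf)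
        ultimately show ?thesis using insert.hyps by (simp add: z_def)
      qed
      show ?thesis using y eq by metis
    next
      case False
      define A where "A = {u \<in> S. 0 < u j}"
      define B where "B = {u \<in> S. u j < 0}"
      define Z where "Z = {u \<in> S. u j = 0}"
      \<comment> \<open>The inequalities in \<open>A\<close> bound the unknown \<open>y j\<close> from below, those in \<open>B\<close> from above; \<open>m a b\<close> says
        that the bound from \<open>a\<close> is smaller than the bound from \<open>b\<close>.\<close>
      define m where "m a b = (\<lambda>i. a j * b i + (- b j) * a i)" for a b :: "'i \<Rightarrow> 'k"
      define S' where "S' = Z \<union> (\<lambda>(a, b). m a b) ` (A \<times> B)"
      have fin: "finite A" "finite B" "finite Z" using insert.prems(1)
        by (auto simp: A_def B_def Z_def)
      have "\<exists>y. (\<forall>u\<in>S'. 0 < (\<Sum>i\<in>I. u i * y i)) \<and> (\<forall>u\<in>E. (\<Sum>i\<in>I. u i * y i) = 0)"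
      proof (rule insert.IH)
        show "finite S'" using fin by (simp add: S'_def)
        have "m a b \<in> P" if "a \<in> A" "b \<in> B" for a b
          unfolding m_def using that insert.prems(2)
          by (intro add[of "\<lambda>i. a j * b i" "\<lambda>i. (- b j) * a i"] scale) (auto simp: A_def B_def)
        then show "S' \<subseteq> P" using insert.prems(2) by (auto simp: S'_def Z_def)
        show "u i = 0" if "u \<in> S' \<union> E" "i \<notin> I" for u i
        proof (cases "i = j")
          case True
          then show ?thesis using that False by (auto simp: S'_def Z_def m_def)
        next
          case False
          then have "w i = 0" if "w \<in> S \<union> E" for w
            using that \<open>i \<notin> I\<close> insert.prems(3)[of w i] by blast
          then have mz: "m a b i = 0" if "a \<in> A" "b \<in> B" for a b
            using that
            by (metis (no_types, lifting) A_def B_def CollectD UnI1 m_def add_0 mult_zero_right)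
          consider "u \<in> S \<union> E" | a b where "a \<in> A" "b \<in> B" "u = m a b"
            using \<open>u \<in> S' \<union> E\<close> unfolding S'_def Z_def by auto
          then show ?thesis using mz \<open>\<And>w. w \<in> S \<union> E \<Longrightarrow> w i = 0\<close>[of u] by cases simp_all
        qed
      qed (use insert.prems in auto)
      then obtain y where y: "\<And>u. u \<in> S' \<Longrightarrow> 0 < (\<Sum>i\<in>I. u i * y i)"
          "\<And>u. u \<in> E \<Longrightarrow> (\<Sum>i\<in>I. u i * y i) = 0"
        by blast
      define q where "q u = - (\<Sum>i\<in>I. u i * y i) / u j" for u
      have qq: "q a < q b" if "a \<in> A" "b \<in> B" for a b
      proof -
        have pos: "0 < a j" "b j < 0" using that by (auto simp: A_def B_def)
        have "0 < (\<Sum>i\<in>I. m a b i * y i)" using that by (intro y(1)) (auto simp: S'_def)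
        also have "\<dots> = a j * (\<Sum>i\<in>I. b i * y i) + (- b j) * (\<Sum>i\<in>I. a i * y i)"
          unfolding m_def
          by (simp add: sum.distrib sum_distrib_left algebra_simps sum_negf sum_subtractf)
        finally show ?thesis using pos by (simp add: q_def field_simps)
      qed
      obtain t where t: "\<And>a. a \<in> A \<Longrightarrow> q a < t" "\<And>b. b \<in> B \<Longrightarrow> t < q b"
      proof (cases "A = {} \<or> B = {}")
        case True
        show ?thesis
        proof (cases "A = {}")
          case True
          have "Min (insert 0 (q ` B)) - 1 < q b" if "b \<in> B" for b
          proof -
            have "Min (insert 0 (q ` B)) \<le> q b" using fin that by (intro Min_le) auto
            then show ?thesis by (meson diff_less_eq less_add_one order_less_le_trans)
          qed
          then show ?thesis using True that by blast
        next
          case False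
          have "q a < Max (insert 0 (q ` A)) + 1" if "a \<in> A" for a
          proof -
            have "q a \<le> Max (insert 0 (q ` A))" using fin that by (intro Max_ge) auto
            then show ?thesis by (meson less_add_one order_le_less_trans)
          qed
          then show ?thesis using True False that by blast
        qed
      next
        case False
        then have "Max (q ` A) < Min (q ` B)" using fin qq by simp
        then obtain t where "Max (q ` A) < t" "t < Min (q ` B)" using dense by blast
        then show ?thesis using that[of t] fin False by simp
      qed
      have eq: "(\<Sum>i\<in>insert j I. u i * (y(j := t)) i) = u j * t + (\<Sum>i\<in>I. u i * y i)" for u
      proof -
        have "(\<Sum>i\<in>I. u i * (y(j := t)) i) = (\<Sum>i\<in>I. u i * y i)"
          using insert.hyps(2) by (intro sum.cong) auto
        then show ?thesis using insert.hyps by simp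
      qed
      have "0 < (\<Sum>i\<in>insert j I. u i * (y(j := t)) i)" if u: "u \<in> S" for u
      proof -
        consider "u \<in> A" | "u \<in> B" | "u \<in> Z" using u linorder_less_linear[of "u j" 0]
          by (auto simp: A_def B_def Z_def)
        then show ?thesis
        proof cases
          case 1
          then show ?thesis using t(1)[OF 1] unfolding eq q_def by (simp add: A_def field_simps)
        next
          case 2
          then show ?thesis using t(2)[OF 2] unfolding eq q_def by (simp add: B_def field_simps)
        next
          case 3
          then show ?thesis using y(1)[of u] unfolding eq by (simp add: Z_def S'_def)
        qed
      qed
      moreover have "(\<Sum>i\<in>insert j I. u i * (y(j := t)) i) = 0" if "u \<in> E" for u
        using y(2)[OF that] False that unfolding eq by simp
      ultimately show ?thesis by blast
    qed
  qed
  then show ?thesis using that by blast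
qed

section \<open>Density of the value group\<close>
lemma abs_hom:
  fixes v :: "'k::linordered_field \<Rightarrow> real"
  assumes v: "compatible_nonarch_abs v"
  shows abs_inverse: "v (inverse x) = inverse (v x)" and abs_power: "v (x ^ n) = v x ^ n"
proof -
  interpret signed_seminormed "(*)" v "signed_abs v" by (rule signed_seminormed_signed_abs[OF v])
  have mult: "v (a * b) = v a * v b" and z: "v a = 0 \<longleftrightarrow> a = 0" for a b
    using v unfolding compatible_nonarch_abs_def by blast+
  show "v (x ^ n) = v x ^ n" by (induction n) (simp_all add: mult abs_one)
  show "v (inverse x) = inverse (v x)"
  proof (cases "x = 0")
    case True then show ?thesis using z[of 0] by simp
  next
    case False
    then have "v x * v (inverse x) = 1" by (simp flip: mult add: abs_one)
    then show ?thesis by (metis inverse_unique)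
  qed
qed

text \<open>
  Iterated square roots of an element of absolute value above 1 have absolute values that exceed 1
  by arbitrarily little, so powers of such a root hit every interval.
\<close>
lemma abs_dense_pos:
  fixes v :: "'k::real_closed_field \<Rightarrow> real"
  assumes v: "compatible_nonarch_abs v" and nt: "\<not> trivial_abs v" and "0 < \<alpha>" "\<alpha> < \<beta>"
  obtains a where "0 < a" "\<alpha> < v a" "v a < \<beta>"
proof -
  interpret signed_seminormed "(*)" v "signed_abs v" by (rule signed_seminormed_signed_abs[OF v])
  have mult: "v (a * b) = v a * v b" and v0: "0 \<le> v a" for a b
    using v unfolding compatible_nonarch_abs_def by blast+
  obtain x where x: "0 < x" "1 < v x"
  proof -
    obtain x0 where x0: "x0 \<noteq> 0" "v x0 \<noteq> 1" using nt unfolding trivial_abs_def by blast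
    define x1 where "x1 = \<bar>x0\<bar>"
    have x1: "0 < x1" "v x1 \<noteq> 1" using x0 abs_minus[of x0] by (auto simp: x1_def abs_if)
    show ?thesis
    proof (cases "1 < v x1")
      case False
      then have "1 < v (inverse x1)" using x1 abs_pos[of x1]
        by (simp add: abs_inverse[OF v] one_less_inverse_iff)
      then show ?thesis using that[of "inverse x1"] x1 by simp
    qed (use that x1 in blast)
  qed
  have roots: "\<exists>y>0. v y ^ (2 ^ k) = v x" for k
  proof (induction k)
    case (Suc k)
    then obtain y where y: "0 < y" "v y ^ (2 ^ k) = v x" by blast
    obtain z where z: "z * z = y" using nonneg_square[of y] y by auto
    have "\<bar>z\<bar> * \<bar>z\<bar> = y" using z y by (simp add: abs_mult_self_eq)
    moreover have "\<bar>z\<bar> > 0" using z y by auto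
    moreover have "v \<bar>z\<bar> ^ (2 ^ Suc k) = (v \<bar>z\<bar> * v \<bar>z\<bar>) ^ (2 ^ k)"
      by (simp add: power_mult power2_eq_square)
    ultimately show ?case using y(2) mult[of "\<bar>z\<bar>" "\<bar>z\<bar>"] by metis
  qed (use x in auto)
  have large: "\<exists>a>0. \<alpha> < v a \<and> v a < \<beta>" if ab: "1 \<le> \<alpha>" "\<alpha> < \<beta>" for \<alpha> \<beta> :: real
  proof -
    have ratio: "1 < \<beta> / \<alpha>" using ab by simp
    obtain k where k: "v x < (\<beta> / \<alpha>) ^ k" using real_arch_pow[OF ratio] by blast
    also have "\<dots> \<le> (\<beta> / \<alpha>) ^ (2 ^ k)" using ratio
      by (intro power_increasing) (auto intro: less_imp_le less_exp)
    finally have k: "v x < (\<beta> / \<alpha>) ^ (2 ^ k)" .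
    obtain y where y: "0 < y" "v y ^ (2 ^ k) = v x" using roots by blast
    have "v y < \<beta> / \<alpha>"
      using k y(2) power_mono[of "\<beta> / \<alpha>" "v y" "2 ^ k"] ratio by force
    have "1 < v y" using x y(2) power_mono[of "v y" 1 "2 ^ k"] v0[of y] by force
    \<comment> \<open>The first power beyond \<open>\<alpha>\<close> exceeds \<open>\<alpha>\<close> by a factor of at most \<open>v y < \<beta> / \<alpha>\<close>.\<close>
    define m where "m = (LEAST m. \<alpha> < v y ^ m)"
    have m: "\<alpha> < v y ^ m" unfolding m_def by (rule LeastI_ex) (rule real_arch_pow[OF \<open>1 < v y\<close>])
    then have "m \<noteq> 0" using ab by (intro notI) simp
    then obtain m' where m': "m = Suc m'" using not0_implies_Suc by blast
    have "v y ^ m' \<le> \<alpha>" using not_less_Least[of m' "\<lambda>m. \<alpha> < v y ^ m"] m' by (simp add: m_def)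
    then have "v y * v y ^ m' \<le> v y * \<alpha>" using v0[of y] by (intro mult_left_mono)
    also have "\<dots> < \<beta>" using \<open>v y < \<beta> / \<alpha>\<close> ab by (simp add: field_simps)
    finally have "v y ^ m < \<beta>" by (simp add: m')
    then show ?thesis using m y(1) by (intro exI[of _ "y ^ m"]) (simp add: abs_power[OF v])
  qed
  consider "1 \<le> \<alpha>" | "\<alpha> < 1" "1 < \<beta>" | "\<beta> \<le> 1" by linarith
  then show ?thesis
  proof cases
    case 1
    then show ?thesis using large[of \<alpha> \<beta>] assms(4) that by blast
  next
    case 2
    then show ?thesis using that[of 1] abs_one by simp
  next
    case 3
    then obtain a where a: "0 < a" "1 / \<beta> < v a" "v a < 1 / \<alpha>"
      using large[of "1 / \<beta>" "1 / \<alpha>"] assms(3,4) by (auto simp: field_simps)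
    then have "\<alpha> < inverse (v a)" "inverse (v a) < \<beta>"
      using abs_pos[of a] assms(3,4) by (simp_all add: field_simps)
    then show ?thesis using that[of "inverse a"] a(1) by (simp add: abs_inverse[OF v])
  qed
qed

lemma signed_abs_dense:
  fixes v :: "'k::real_closed_field \<Rightarrow> real"
  assumes v: "compatible_nonarch_abs v" and nt: "\<not> trivial_abs v" and "\<alpha> < \<beta>"
  obtains a where "\<alpha> < signed_abs v a" "signed_abs v a < \<beta>"
proof (cases "0 < \<beta>")
  case True
  define \<gamma> where "\<gamma> = max \<alpha> (\<beta> / 2)"
  have "0 < \<gamma>" "\<gamma> < \<beta>" "\<alpha> \<le> \<gamma>" using True assms(3) by (auto simp: \<gamma>_def)
  then obtain a where "0 < a" "\<gamma> < v a" "v a < \<beta>" using abs_dense_pos[OF v nt] by blast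
  then show ?thesis using that[of a] \<open>\<alpha> \<le> \<gamma>\<close> signed_abs_of_nonneg[OF v, of a] by simp
next
  case False
  define \<gamma> where "\<gamma> = max (- \<beta>) (- \<alpha> / 2)"
  have "0 < \<gamma>" "\<gamma> < - \<alpha>" "- \<beta> \<le> \<gamma>" using False assms(3) by (auto simp: \<gamma>_def)
  then obtain a where "0 < a" "\<gamma> < v a" "v a < - \<alpha>" using abs_dense_pos[OF v nt] by blast
  then show ?thesis
    using that[of "- a"] \<open>- \<beta> \<le> \<gamma>\<close> signed_abs_of_nonneg[OF v, of a] signed_abs_minus[OF v, of a]
    by simp
qed

section \<open>Functionals in coordinates\<close>
lift_definition functional_of :: "('n::finite \<Rightarrow> 'k::field) \<Rightarrow> ('k, 'n) dual"
  is "\<lambda>a x. \<Sum>i\<in>UNIV. a i * x $ i"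
  by (simp add: linear_functional_iff algebra_simps sum.distrib sum_distrib_left)

definition dual_coeffs :: "('k::field, 'n::finite) dual \<Rightarrow> 'n \<Rightarrow> 'k" where
  "dual_coeffs f i = dual_apply f (axis i 1)"

lemma dual_apply_coeffs: "dual_apply f x = (\<Sum>i\<in>UNIV. dual_coeffs f i * x $ i)"
proof -
  have lin: "dual_apply f (x + y) = dual_apply f x + dual_apply f y"
      "dual_apply f (c *s x) = c * dual_apply f x" for c x y
    using dual_apply[of f] by (simp_all add: linear_functional_iff)
  have "dual_apply f 0 = 0" using lin(2)[of 0 0] by simp
  have "dual_apply f (\<Sum>i\<in>A. x $ i *s axis i 1) = (\<Sum>i\<in>A. x $ i * dual_coeffs f i)" if "finite A"
    for A
    using that
    by (induction A rule: finite_induct) (simp_all add: lin \<open>dual_apply f 0 = 0\<close> dual_coeffs_def)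
  from this[of UNIV] show ?thesis by (simp add: basis_expansion mult.commute)
qed

lemma functional_of_coeffs [simp]: "functional_of (dual_coeffs f) = f"
  by (simp add: dual_apply_inject[symmetric] functional_of.rep_eq dual_apply_coeffs fun_eq_iff)

lemma functional_of_add: "functional_of (\<lambda>i. a i + b i) = functional_of a + functional_of b"
  by transfer (simp add: algebra_simps sum.distrib)

lemma functional_of_scale: "functional_of (\<lambda>i. c * a i) = dual_scale c (functional_of a)"
  by transfer (simp add: algebra_simps sum_distrib_left)

lemma functional_of_zero: "functional_of (\<lambda>i. 0) = 0"
  by transfer simp

lemma dual_base_change_coeffs: "dual_base_change h f = functional_of (\<lambda>i. h (dual_coeffs f i))"
  unfolding dual_coeffs_def by transfer simp

lemma dual_apply_add: "dual_apply (f + g) x = dual_apply f x + dual_apply g x"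
  and dual_apply_scale: "dual_apply (dual_scale c f) x = c * dual_apply f x"
  and dual_apply_minus: "dual_apply (- f) x = - dual_apply f x"
  and dual_apply_zero: "dual_apply 0 x = 0"
  by (transfer; simp)+

lemma dual_apply_vec: "dual_apply f (x + y) = dual_apply f x + dual_apply f y"
    "dual_apply f (c *s x) = c * dual_apply f x"
  using dual_apply[of f] by (simp_all add: linear_functional_iff)

lemma signed_seminormed_dual:
  "compatible_nonarch_abs v \<Longrightarrow> signed_seminorm v dual_scale N \<Longrightarrow> signed_seminormed dual_scale v N"
  by (intro signed_seminormed.intro signed_seminormed_axioms.intro dual.vector_space_axioms)

section \<open>Approximating seminorms by points\<close>
lemma (in signed_seminormed) add_trichotomy:
  "min (N x) (N y) \<le> N (x + y)" "N (x + y) \<le> max (N x) (N y)"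
  "0 \<le> N x \<Longrightarrow> 0 \<le> N y \<Longrightarrow> N (x + y) = max (N x) (N y)"
  "\<bar>N y\<bar> < \<bar>N x\<bar> \<Longrightarrow> N (x + y) = N x" "\<bar>N x\<bar> < \<bar>N y\<bar> \<Longrightarrow> N (x + y) = N y"
  using add_lower add_upper add_nonneg add_dominant[of y x] add_dominant[of x y]
  by (simp_all add: add.commute)

text \<open>
  The sum of two signed seminorms on a direct sum need not be one, but it has the sign of its larger
  summand and vanishes only if the summands cancel. Hence its positive part behaves like the
  positive cone of an ordering.
\<close>
lemma positive_sum_add:
  assumes "signed_seminormed s v N" "signed_seminormed s' v' M"
    and "0 < N x + M x'" "0 < N y + M y'"
  shows "0 < N (x + y) + M (x' + y')"
  using signed_seminormed.add_trichotomy[OF assms(1), where x = x and y = y]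
    signed_seminormed.add_trichotomy[OF assms(2), where x = x' and y = y'] assms(3,4)
      by (smt (verit))

text \<open>
  The unknown is a pair \<open>(x, t)\<close> with \<open>t > 0\<close>, stored in the coordinates \<open>Some i\<close>
    and \<open>None\<close>, so that
  the affine conditions \<open>a f < f x < b f\<close> become linear; dividing by \<open>t\<close> recovers the point.
\<close>
lemma approximation_nontrivial:
  fixes v :: "'k::real_closed_field \<Rightarrow> real" and N :: "('k, 'n::finite) dual \<Rightarrow> real"
  assumes v: "compatible_nonarch_abs v" and nt: "\<not> trivial_abs v"
    and N: "signed_seminorm v dual_scale N" and F: "finite F" and "0 < \<epsilon>"
  obtains x where "\<And>f. f \<in> F \<Longrightarrow> \<bar>signed_abs v (dual_apply f x) - N f\<bar> < \<epsilon>"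
proof -
  interpret N: signed_seminormed dual_scale v N by (rule signed_seminormed_dual[OF v N])
  interpret s: signed_seminormed "(*)" v "signed_abs v" by (rule signed_seminormed_signed_abs[OF v])
  have "\<exists>a. N f - \<epsilon> < signed_abs v a \<and> signed_abs v a < N f"
      "\<exists>a. N f < signed_abs v a \<and> signed_abs v a < N f + \<epsilon>" for f
    using signed_abs_dense[OF v nt, of "N f - \<epsilon>" "N f"]
        signed_abs_dense[OF v nt, of "N f" "N f + \<epsilon>"] \<open>0 < \<epsilon>\<close>
    by (metis diff_gt_0_iff_gt diff_diff_eq2 add_diff_cancel_left' less_add_same_cancel1)+
  then obtain a b where a: "N f - \<epsilon> < signed_abs v (a f)" "signed_abs v (a f) < N f"
    and b: "N f < signed_abs v (b f)" "signed_abs v (b f) < N f + \<epsilon>" for f by metis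
  define P :: "('n option \<Rightarrow> 'k) set" where
    "P = {u. 0 < N (functional_of (\<lambda>i. u (Some i))) + signed_abs v (u None)}"
  define vec :: "('k, 'n) dual \<Rightarrow> 'k \<Rightarrow> 'n option \<Rightarrow> 'k" where
    "vec f c = case_option c (dual_coeffs f)" for f c
  define S where "S = insert (vec 0 1) ((\<lambda>f. vec f (- a f)) ` F \<union> (\<lambda>f. vec (- f) (b f)) ` F)"
  have vec: "functional_of (\<lambda>i. vec f c (Some i)) = f" "vec f c None = c" for f c
    by (simp_all add: vec_def)
  obtain y where y: "\<And>u. u \<in> S \<Longrightarrow> 0 < (\<Sum>i\<in>UNIV. u i * y i)"
  proof (rule separating_vector[of UNIV P S "{}"])
    show "(\<lambda>i. x i + y i) \<in> P" if "x \<in> P" "y \<in> P" for x y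
      using that positive_sum_add[OF N.signed_seminormed_axioms s.signed_seminormed_axioms]
      by (simp add: P_def functional_of_add)
    show "(\<lambda>i. c * x i) \<in> P" if "0 < c" "x \<in> P" for c x
      using that s.abs_pos[of c]
      by (simp add: P_def functional_of_scale N.scale_pos s.scale_pos flip: distrib_left)
    show "S \<subseteq> P"
      using a b by (auto simp: S_def P_def vec signed_abs_one[OF v] signed_abs_minus[OF v])
  qed (use F that in \<open>auto simp: S_def P_def functional_of_zero\<close>)
  have sum_vec: "(\<Sum>i\<in>UNIV. vec f c i * y i) = c * y None + (\<Sum>i\<in>UNIV. dual_coeffs f i * y (Some i))"
    for f c
    by (simp add: UNIV_option_conv sum.reindex vec_def)
  define t where "t = y None"
  have t: "0 < t" using y[of "vec 0 1"]
    by (simp add: S_def sum_vec t_def dual_coeffs_def dual_apply_zero)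
  define x where "x = (\<chi> i. y (Some i) / t)"
  have x: "(\<Sum>i\<in>UNIV. dual_coeffs f i * y (Some i)) = t * dual_apply f x" for f
    using t by (simp add: dual_apply_coeffs x_def sum_distrib_left)
  have "\<bar>signed_abs v (dual_apply f x) - N f\<bar> < \<epsilon>" if "f \<in> F" for f
  proof -
    have "0 < - a f * t + t * dual_apply f x"
      using y[of "vec f (- a f)"] that by (simp add: S_def sum_vec x t_def)
    then have "0 < t * (dual_apply f x - a f)" by (simp add: algebra_simps)
    then have "a f \<le> dual_apply f x" using t by (simp add: zero_less_mult_iff)
    moreover have "0 < b f * t + t * dual_apply (- f) x"
      using y[of "vec (- f) (b f)"] that by (simp add: S_def sum_vec x t_def)
    then have "0 < t * (b f - dual_apply f x)" by (simp add: algebra_simps dual_apply_minus)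
    then have "dual_apply f x \<le> b f" using t by (simp add: zero_less_mult_iff)
    ultimately show ?thesis
      using signed_abs_mono[OF v, of "a f" "dual_apply f x"]
          signed_abs_mono[OF v, of "dual_apply f x" "b f"] a[of f] b[of f]
      by linarith
  qed
  then show ?thesis using that by blast
qed

text \<open>Positive elements are squares, so a field homomorphism between such fields preserves signs.\<close>
lemma valued_extension_signed_abs:
  fixes v :: "'k::real_closed_field \<Rightarrow> real" and w :: "'l::linordered_field \<Rightarrow> real"
  assumes h: "valued_extension v w h"
  shows "h 0 = 0" and "h (x * y) = h x * h y" and "h (x + y) = h x + h y" and "h (- x) = - h x"
    and "0 < x \<Longrightarrow> 0 < h x" and "signed_abs w (h x) = signed_abs v x" and "w (h x) = v x"
proof -
  have add: "h (x + y) = h x + h y" and mult: "h (x * y) = h x * h y" and one: "h 1 = 1" and w: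
      "w (h x) = v x" for x y
    using h unfolding valued_extension_def by blast+
  show zero: "h 0 = 0" using add[of 0 0] by simp
  have minus: "h (- x) = - h x" for x using add[of x "- x"] zero
    by (simp add: eq_neg_iff_add_eq_0 add.commute)
  have pos: "0 < h x" if "0 < x" for x
  proof -
    obtain y where "y * y = x" using nonneg_square[of x] \<open>0 < x\<close> by auto
    then have "h x = h y * h y" using mult by metis
    moreover have "h x * h (inverse x) = 1" using mult[of x "inverse x"] one \<open>0 < x\<close> by simp
    ultimately show ?thesis
      by (metis linorder_neqE_linordered_idom mult_zero_left not_square_less_zero zero_neq_one)
  qed
  show "h (x * y) = h x * h y" "h (x + y) = h x + h y" "h (- x) = - h x" "0 < x \<Longrightarrow> 0 < h x"
      "w (h x) = v x"
    using add mult minus pos w by blast+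
  show "signed_abs w (h x) = signed_abs v x"
    using pos[of x] pos[of "- x"] minus[of x] zero w[of x]
    by (auto simp: signed_abs_def real_sgn_def)
qed

text \<open>
  For trivial \<open>v\<close> the sets \<open>{g. \<bar>N g\<bar> < r}\<close> are subspaces, which is why they can be imposed as
  equations on the vector \<open>y r\<close>.
\<close>
lemma approximation_trivial:
  fixes v :: "'k::real_closed_field \<Rightarrow> real" and w :: "'l::real_closed_field \<Rightarrow> real"
    and N :: "('k, 'n::finite) dual \<Rightarrow> real"
  assumes v: "compatible_nonarch_abs v" and triv: "trivial_abs v"
    and w: "compatible_nonarch_abs w" and nt: "\<not> trivial_abs w" and h: "valued_extension v w h"
    and N: "signed_seminorm v dual_scale N" and F: "finite F" and "0 < \<epsilon>"
  obtains x :: "'l ^ 'n" where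
      "\<And>f. f \<in> F \<Longrightarrow> \<bar>signed_abs w (dual_apply (dual_base_change h f) x) - N f\<bar> < \<epsilon>"
proof -
  interpret N: signed_seminormed dual_scale v N by (rule signed_seminormed_dual[OF v N])
  interpret s: signed_seminormed "(*)" w "signed_abs w" by (rule signed_seminormed_signed_abs[OF w])
  note h = valued_extension_signed_abs[OF h]
  have v1: "v c = 1" if "c \<noteq> 0" for c using triv that by (simp add: trivial_abs_def)
  define R where "R = (\<lambda>f. \<bar>N f\<bar>) ` F - {0}"
  have R: "finite R" "\<And>r. r \<in> R \<Longrightarrow> 0 < r" using F by (auto simp: R_def)
  define good :: "real \<Rightarrow> ('n \<Rightarrow> 'k) \<Rightarrow> bool" where "good r y \<longleftrightarrow>
      (\<forall>f\<in>F. (N f = r \<longrightarrow> 0 < (\<Sum>i\<in>UNIV. dual_coeffs f i * y i)) \<and>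
      (N f = - r \<longrightarrow> (\<Sum>i\<in>UNIV. dual_coeffs f i * y i) < 0) \<and>
      (\<bar>N f\<bar> < r \<longrightarrow> (\<Sum>i\<in>UNIV. dual_coeffs f i * y i) = 0))" for r y
  have "\<exists>y. good r y"
    if r: "0 < r" for r
  proof -
    define P :: "('n \<Rightarrow> 'k) set" where "P = {u. r \<le> N (functional_of u)}"
    define S where "S = dual_coeffs ` {f \<in> F \<union> uminus ` F. N f = r}"
    define E where "E = dual_coeffs ` {f \<in> F. \<bar>N f\<bar> < r}"
    obtain y where y: "\<And>u. u \<in> S \<Longrightarrow> 0 < (\<Sum>i\<in>UNIV. u i * y i)" "\<And>u. u \<in> E \<Longrightarrow> (\<Sum>i\<in>UNIV. u i * y i) = 0"
    proof (rule separating_vector[of UNIV P S E])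
      show "(\<lambda>i. x i + y i) \<in> P" if "x \<in> P" "y \<in> P" for x y
        using that r N.add_lower[of "functional_of x" "functional_of y"]
        by (simp add: P_def functional_of_add)
      show "(\<lambda>i. c * x i) \<in> P" if "0 < c" "x \<in> P" for c x
        using that by (simp add: P_def functional_of_scale N.scale_pos v1)
      show "S \<subseteq> P" by (auto simp: S_def P_def)
      show "(\<lambda>i. x i + c * e i) \<in> P" if "e \<in> E" "x \<in> P" for e c x
      proof -
        obtain f where f: "e = dual_coeffs f" "\<bar>N f\<bar> < r" using \<open>e \<in> E\<close> by (auto simp: E_def)
        have "\<bar>N (dual_scale c f)\<bar> < r" using f(2) v1[of c] r
          by (cases "c = 0") (auto simp: N.abs_scale)
        then have "N (functional_of x + dual_scale c f) = N (functional_of x)"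
          using \<open>x \<in> P\<close> by (intro N.add_dominant) (simp add: P_def)
        then show ?thesis using \<open>x \<in> P\<close>
          by (simp add: P_def functional_of_add functional_of_scale f(1))
      qed
    qed (use F r that in \<open>auto simp: S_def E_def P_def functional_of_zero\<close>)
    have "(\<Sum>i\<in>UNIV. dual_coeffs f i * y i) < 0" if "f \<in> F" "N f = - r" for f
    proof -
      have "dual_coeffs (- f) \<in> S" using that by (auto simp: S_def)
      then have "0 < (\<Sum>i\<in>UNIV. dual_coeffs (- f) i * y i)" by (rule y(1))
      then show ?thesis by (simp add: dual_coeffs_def dual_apply_minus sum_negf)
    qed
    then show ?thesis using y by (intro exI[of _ y]) (auto simp: good_def S_def E_def)
  qed
  then obtain y where good: "0 < r \<Longrightarrow> good r (y r)" for r by metis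
  then have y: "\<And>r f. 0 < r \<Longrightarrow> f \<in> F \<Longrightarrow> N f = r \<Longrightarrow> 0 < (\<Sum>i\<in>UNIV. dual_coeffs f i * y r i)"
      "\<And>r f. 0 < r \<Longrightarrow> f \<in> F \<Longrightarrow> N f = - r \<Longrightarrow> (\<Sum>i\<in>UNIV. dual_coeffs f i * y r i) < 0"
      "\<And>r f. 0 < r \<Longrightarrow> f \<in> F \<Longrightarrow> \<bar>N f\<bar> < r \<Longrightarrow> (\<Sum>i\<in>UNIV. dual_coeffs f i * y r i) = 0"
    unfolding good_def by blast+
  \<comment> \<open>Besides being close to \<open>r\<close>, the absolute value of \<open>t r\<close> has to stay above all smaller elements of \<open>R\<close>,
    so that in the sum \<open>x\<close> below the term for the largest relevant \<open>r\<close> dominates.\<close>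
  have "\<exists>t>0. r - \<epsilon> < w t \<and> w t < r \<and> (\<forall>r'\<in>R. r' < r \<longrightarrow> r' < w t)" if r: "r \<in> R" for r
  proof -
    define p where "p = Max (insert (max (r / 2) (r - \<epsilon>)) {r' \<in> R. r' < r})"
    have fin: "finite (insert (max (r / 2) (r - \<epsilon>)) {r' \<in> R. r' < r})" using R by simp
    have "p \<in> insert (max (r / 2) (r - \<epsilon>)) {r' \<in> R. r' < r}" unfolding p_def using fin
      by (intro Max_in) auto
    then have "p < r" using \<open>0 < \<epsilon>\<close> R(2)[OF r] by auto
    have le: "q \<le> p" if "q \<in> insert (max (r / 2) (r - \<epsilon>)) {r' \<in> R. r' < r}" for q
      unfolding p_def using fin that by (rule Max_ge)
    have "max (r / 2) (r - \<epsilon>) \<le> p" by (rule le) simp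
    then have "0 < p" "r - \<epsilon> \<le> p" using R(2)[OF r] by auto
    then obtain t where "0 < t" "p < w t" "w t < r" using abs_dense_pos[OF w nt _ \<open>p < r\<close>] by blast
    then show ?thesis using le \<open>r - \<epsilon> \<le> p\<close> by (intro exI[of _ t]) force
  qed
  then obtain t where t: "\<And>r. r \<in> R \<Longrightarrow> 0 < t r" "\<And>r. r \<in> R \<Longrightarrow> r - \<epsilon> < w (t r)"
      "\<And>r. r \<in> R \<Longrightarrow> w (t r) < r"
    "\<And>r r'. r \<in> R \<Longrightarrow> r' \<in> R \<Longrightarrow> r' < r \<Longrightarrow> r' < w (t r)" by metis
  define x :: "'l ^ 'n" where "x = (\<chi> i. \<Sum>r\<in>R. t r * h (y r i))"
  have hsum: "h (sum g A) = (\<Sum>i\<in>A. h (g i))" if "finite A" for g and A :: "'n set"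
    using that by (induction A rule: finite_induct) (simp_all add: h)
  have eval:
      "dual_apply (dual_base_change h f) x = (\<Sum>r\<in>R. t r * h (\<Sum>i\<in>UNIV. dual_coeffs f i * y r i))"
    for f
  proof -
    have "dual_apply (dual_base_change h f) x = (\<Sum>i\<in>UNIV. \<Sum>r\<in>R. t r * (h (dual_coeffs f i) * h (y r i)))"
      by (simp add: dual_base_change_coeffs functional_of.rep_eq x_def sum_distrib_left algebra_simps)
    also have "\<dots> = (\<Sum>r\<in>R. \<Sum>i\<in>UNIV. t r * (h (dual_coeffs f i) * h (y r i)))" by (rule sum.swap)
    finally show ?thesis by (simp add: hsum h sum_distrib_left)
  qed
  have "\<bar>signed_abs w (dual_apply (dual_base_change h f) x) - N f\<bar> < \<epsilon>" if f: "f \<in> F" for f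
  proof (cases "N f = 0")
    case True
    then have "dual_apply (dual_base_change h f) x = 0"
      unfolding eval using y(3)[OF R(2) f] R(2) by (intro sum.neutral) (auto simp: h)
    then show ?thesis using True \<open>0 < \<epsilon>\<close> by (simp add: signed_abs_zero[OF w])
  next
    case False
    define \<rho> where "\<rho> = \<bar>N f\<bar>"
    have \<rho>: "\<rho> \<in> R" using False f by (auto simp: R_def \<rho>_def)
    define q where "q r = (\<Sum>i\<in>UNIV. dual_coeffs f i * y r i)" for r
    have split: "dual_apply (dual_base_change h f) x = t \<rho> * h (q \<rho>) + (\<Sum>r\<in>R - {\<rho>}. t r * h (q r))"
      unfolding eval q_def using R(1) \<rho> by (rule sum.remove)
    have vq: "v (q r) \<le> 1" for r
    proof (cases "q r = 0")
      case True
      then have "v (q r) = 0" using v unfolding compatible_nonarch_abs_def by blast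
      then show ?thesis by simp
    qed (simp add: v1)
    have small: "\<bar>signed_abs w (t r * h (q r))\<bar> < w (t \<rho>)" if "r \<in> R - {\<rho>}" for r
    proof (cases "r < \<rho>")
      case True
      have "\<bar>signed_abs w (t r * h (q r))\<bar> = w (t r) * v (q r)"
        by (simp add: signed_abs_mult[OF w] abs_mult abs_signed_abs[OF w] abs_signed_abs[OF v] h)
      also have "\<dots> \<le> w (t r) * 1"
        using vq w unfolding compatible_nonarch_abs_def by (intro mult_left_mono) auto
      also have "\<dots> < r" using t(3) that by simp
      also have "\<dots> < w (t \<rho>)" using t(4) \<rho> that True by blast
      finally show ?thesis .
    next
      case False
      then have "q r = 0" unfolding q_def using that f R(2) by (intro y(3)) (auto simp: \<rho>_def)
      then show ?thesis using s.abs_pos[of "t \<rho>"] t(1)[OF \<rho>] by (simp add: h signed_abs_zero[OF w])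
    qed
    have "q \<rho> \<noteq> 0" using y(1,2)[OF R(2)[OF \<rho>] f] by (cases "0 \<le> N f") (auto simp: q_def \<rho>_def)
    have lead: "\<bar>signed_abs w (t \<rho> * h (q \<rho>))\<bar> = w (t \<rho>)"
      using v1[OF \<open>q \<rho> \<noteq> 0\<close>]
      by (simp add: signed_abs_mult[OF w] abs_mult abs_signed_abs[OF w] abs_signed_abs[OF v] h)
    have tail: "\<bar>signed_abs w (\<Sum>r\<in>R - {\<rho>}. t r * h (q r))\<bar> < w (t \<rho>)"
      using R(1) small s.abs_pos[of "t \<rho>"] t(1)[OF \<rho>] by (intro s.abs_sum_less) auto
    have "signed_abs w (dual_apply (dual_base_change h f) x) = signed_abs w (t \<rho> * h (q \<rho>))"
      unfolding split using tail lead by (intro s.add_dominant) simp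
    also have "\<dots> = w (t \<rho>) * signed_abs v (q \<rho>)"
      using t(1)[OF \<rho>] by (simp add: signed_abs_mult[OF w] signed_abs_of_nonneg[OF w] h)
    also have "signed_abs v (q \<rho>) = sgn (N f)"
    proof (cases "0 < N f")
      case True
      then have "0 < q \<rho>" using y(1)[OF R(2)[OF \<rho>] f] by (simp add: q_def \<rho>_def)
      then show ?thesis using True v1[of "q \<rho>"] by (simp add: signed_abs_def real_sgn_def)
    next
      case F: False
      then have "q \<rho> < 0" using False y(2)[OF R(2)[OF \<rho>] f] by (simp add: q_def \<rho>_def)
      then show ?thesis using False F v1[of "q \<rho>"] by (simp add: signed_abs_def real_sgn_def)
    qed
    finally show ?thesis using t(2,3)[OF \<rho>] False
      by (auto simp: \<rho>_def sgn_real_def abs_if split: if_splits)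
  qed
  then show ?thesis using that by blast
qed

section \<open>Homogeneous coordinates\<close>
abbreviation proj_class :: "('i \<Rightarrow> 'a::{times,zero}) \<Rightarrow> ('i \<Rightarrow> 'a) set" where
  "proj_class \<equiv> scalar_class pointwise_scale"

abbreviation emb_class :: "(nat \<Rightarrow> ('k::field, 'n::finite) dual) \<Rightarrow> (nat \<Rightarrow> ('k, 'n) dual) set" where
  "emb_class \<equiv> scalar_class (\<lambda>c f i. dual_scale c (f i))"

lemma mem_proj_class: "x \<in> proj_class y \<longleftrightarrow> (\<exists>c. c \<noteq> 0 \<and> x = (\<lambda>i. c * y i))"
  by (auto simp: scalar_class_def pointwise_scale_def)

lemma proj_class_self [simp]: "(x :: 'i \<Rightarrow> 'a::field) \<in> proj_class x"
  unfolding mem_proj_class by (intro exI[of _ 1]) simp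

lemma proj_class_scale:
  fixes x :: "'i \<Rightarrow> 'a::field"
  assumes "c \<noteq> 0"
  shows "proj_class (\<lambda>i. c * x i) = proj_class x"
proof (intro set_eqI iffI)
  fix y assume "y \<in> proj_class (\<lambda>i. c * x i)"
  then obtain d where "d \<noteq> 0" "y = (\<lambda>i. d * (c * x i))" unfolding mem_proj_class by blast
  then show "y \<in> proj_class x" using assms unfolding mem_proj_class
    by (intro exI[of _ "d * c"]) (simp add: mult.assoc)
next
  fix y assume "y \<in> proj_class x"
  then obtain d where "d \<noteq> 0" "y = (\<lambda>i. d * x i)" unfolding mem_proj_class by blast
  then show "y \<in> proj_class (\<lambda>i. c * x i)" using assms unfolding mem_proj_class
    by (intro exI[of _ "d / c"]) simp
qed

lemma proj_class_eqI: "x \<in> proj_class y \<Longrightarrow> proj_class x = proj_class (y :: 'i \<Rightarrow> 'a::field)"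
  unfolding mem_proj_class using proj_class_scale by blast

lemma proj_class_eqD:
    "proj_class x = proj_class (y :: 'i \<Rightarrow> 'a::field) \<Longrightarrow> \<exists>c. c \<noteq> 0 \<and> x = (\<lambda>i. c * y i)"
  using proj_class_self[of x] by (simp only: mem_proj_class)

lemma proj_spaceE:
  assumes "p \<in> proj_space m"
  obtains x where "x \<in> tuples m" "x \<noteq> 0" "p = proj_class x"
  using assms unfolding projectivization_def by blast

lemma proj_space_class: "proj_class x \<in> proj_space m \<longleftrightarrow> x \<in> tuples m \<and> (x :: nat \<Rightarrow> 'a::field) \<noteq> 0"
proof
  assume "proj_class x \<in> proj_space m"
  then obtain y where y: "y \<in> tuples m" "y \<noteq> 0" "proj_class x = proj_class y" by (rule proj_spaceE)
  then obtain c where "c \<noteq> 0" "x = (\<lambda>i. c * y i)" using proj_class_eqD by blast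
  then show "x \<in> tuples m \<and> x \<noteq> 0" using y by (auto simp: tuples_def fun_eq_iff)
qed (auto simp: projectivization_def)

lemma emb_class_self [simp]: "f \<in> emb_class f"
  unfolding scalar_class_def by (auto intro!: exI[of _ 1])

lemma coord_map_class:
  "coord_map m \<sigma> (proj_class x) = proj_class (\<lambda>j. if j \<le> m then x (\<sigma> j) else (0 :: 'a::field))"
proof -
  have "(\<lambda>j. if j \<le> m then c * x (\<sigma> j) else 0) = (\<lambda>j. c * (if j \<le> m then x (\<sigma> j) else 0))" for c
    by auto
  then show ?thesis
    unfolding coord_map_def scalar_class_def pointwise_scale_def
    by (auto simp: image_iff) metis
qed

lemma emb_map_class:
  "emb_map (emb_class f) (scalar_class (*s) x) = proj_class (\<lambda>i. dual_apply (f i) x)"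
proof (intro set_eqI iffI)
  fix y assume "y \<in> emb_map (emb_class f) (scalar_class (*s) x)"
  then obtain c d where "c \<noteq> 0" "d \<noteq> 0" "y = (\<lambda>i. dual_apply (dual_scale c (f i)) (d *s x))"
    unfolding emb_map_def scalar_class_def by blast
  then show "y \<in> proj_class (\<lambda>i. dual_apply (f i) x)" unfolding mem_proj_class
    by (intro exI[of _ "c * d"]) (simp add: dual_apply_scale dual_apply_vec mult_ac)
next
  fix y assume "y \<in> proj_class (\<lambda>i. dual_apply (f i) x)"
  then obtain c where "c \<noteq> 0" "y = (\<lambda>i. c * dual_apply (f i) x)" unfolding mem_proj_class by blast
  then have "y = (\<lambda>i. dual_apply (f i) (c *s x))" by (simp add: dual_apply_vec)
  then show "y \<in> emb_map (emb_class f) (scalar_class (*s) x)"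
    unfolding emb_map_def using emb_class_self[of f] \<open>c \<noteq> 0\<close> unfolding scalar_class_def[of "(*s)"] by blast
qed

lemma evaluation_class:
  fixes N :: "('k::linordered_field, 'n::finite) dual \<Rightarrow> real"
  assumes "compatible_nonarch_abs v" "signed_seminorm v dual_scale N"
  shows "evaluation (emb_class f) (proj_class N) = proj_class (\<lambda>i. N (f i))"
proof (intro set_eqI iffI)
  fix y assume "y \<in> evaluation (emb_class f) (proj_class N)"
  then obtain c d where cd: "c \<noteq> 0" "d \<noteq> 0" "y = (\<lambda>i. d * N (dual_scale c (f i)))"
    unfolding evaluation_def scalar_class_def pointwise_scale_def by blast
  have "N (dual_scale c g) = signed_abs v c * N g" for g
    using assms(2) unfolding signed_seminorm_def signed_abs_def by blast
  then show "y \<in> proj_class (\<lambda>i. N (f i))" unfolding mem_proj_class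
    using cd
    by (intro exI[of _ "d * signed_abs v c"]) (simp add: mult.assoc signed_abs_eq_zero_iff[OF assms(1)])
next
  fix y assume "y \<in> proj_class (\<lambda>i. N (f i))"
  then obtain c where "c \<noteq> 0" "y = (\<lambda>i. c * N (f i))" unfolding mem_proj_class by blast
  then show "y \<in> evaluation (emb_class f) (proj_class N)"
    unfolding evaluation_def mem_proj_class using emb_class_self[of f]
    by (intro CollectI exI[of _ f] exI[of _ "\<lambda>g. c * N g"]) auto
qed

lemma trop_r_class:
  fixes x :: "nat \<Rightarrow> 'k::linordered_field"
  assumes "compatible_nonarch_abs v"
  shows "trop_r v (proj_class x) = proj_class (\<lambda>i. signed_abs v (x i))"
proof (intro set_eqI iffI)
  fix y assume "y \<in> trop_r v (proj_class x)"
  then obtain c d where "c \<noteq> 0" "d \<noteq> 0" "y = (\<lambda>i. c * signed_abs v (d * x i))"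
    unfolding trop_r_def mem_proj_class by blast
  then show "y \<in> proj_class (\<lambda>i. signed_abs v (x i))" unfolding mem_proj_class
    by (intro exI[of _ "c * signed_abs v d"]) (simp add: signed_abs_mult[OF assms] signed_abs_eq_zero_iff[OF assms] mult.assoc)
next
  fix y assume "y \<in> proj_class (\<lambda>i. signed_abs v (x i))"
  then show "y \<in> trop_r v (proj_class x)"
    unfolding trop_r_def using proj_class_self[of x] unfolding mem_proj_class by blast
qed

lemma emb_base_change_class:
  fixes h :: "'k::linordered_field \<Rightarrow> 'l::linordered_field" and f :: "nat \<Rightarrow> ('k, 'n::finite) dual"
  assumes "\<And>x y. h (x * y) = h x * h y" "h 1 = 1"
  shows "emb_base_change h (emb_class f) = emb_class (\<lambda>i. dual_base_change h (f i))"
proof (intro set_eqI iffI)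
  fix g assume "g \<in> emb_base_change h (emb_class f)"
  then obtain c d where cd: "c \<noteq> 0" "d \<noteq> 0"
      "g = (\<lambda>i. dual_scale c (dual_base_change h (dual_scale d (f i))))"
    unfolding emb_base_change_def scalar_class_def by blast
  have "h d * h (inverse d) = 1" using assms(1)[of d "inverse d"] assms(2) cd(2) by simp
  then have "h d \<noteq> 0" by auto
  have "dual_base_change h (dual_scale d a) = dual_scale (h d) (dual_base_change h a)"
    for a :: "('k, 'n) dual"
    unfolding dual_base_change_coeffs
    by (simp add: dual_coeffs_def dual_apply_scale assms(1) functional_of_scale)
  then have "g = (\<lambda>i. dual_scale (c * h d) (dual_base_change h (f i)))" using cd(3) by simp
  then show "g \<in> emb_class (\<lambda>i. dual_base_change h (f i))"
    unfolding scalar_class_def using \<open>c \<noteq> 0\<close> \<open>h d \<noteq> 0\<close> by (auto intro!: exI[of _ "c * h d"])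
next
  fix g assume "g \<in> emb_class (\<lambda>i. dual_base_change h (f i))"
  then obtain c where "c \<noteq> 0" "g = (\<lambda>i. dual_scale c (dual_base_change h (f i)))"
    unfolding scalar_class_def by blast
  then show "g \<in> emb_base_change h (emb_class f)"
    unfolding emb_base_change_def using emb_class_self[of f] by blast
qed

lemma vec_proj_space_image: "F ` vec_proj_space = {F (scalar_class (*s) x) |x. x \<noteq> 0}"
  unfolding projectivization_def by auto

section \<open>Real tropicalizations of linear spaces\<close>

text \<open>
  The signed seminorms given by points of the linear space (over the extension field if \<open>v\<close> is
  trivial), the zero vector included. Evaluating them on the tuple of an embedding gives the image
  whose closure is the tropicalization, so that statements about tropicalizations become statements
  about signed seminorms.
\<close>
definition trop_points ::
    "('k::linordered_field \<Rightarrow> real) \<Rightarrow> ('l::linordered_field \<Rightarrow> real) \<Rightarrow> ('k \<Rightarrow> 'l) \<Rightarrow>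
     (('k, 'n::finite) dual \<Rightarrow> real) set" where
  "trop_points v w h =
     (if trivial_abs v
      then {(\<lambda>f. signed_abs w (dual_apply (dual_base_change h f) x)) |x. True}
      else {(\<lambda>f. signed_abs v (dual_apply f x)) |x. True})"

text \<open>The standing hypotheses, bundled because they enter almost every statement below.\<close>
definition tropical_data ::
    "('k::real_closed_field \<Rightarrow> real) \<Rightarrow> ('l::real_closed_field \<Rightarrow> real) \<Rightarrow> ('k \<Rightarrow> 'l) \<Rightarrow> bool" where
  "tropical_data v w h \<longleftrightarrow> compatible_nonarch_abs v \<and>
     (trivial_abs v \<longrightarrow> compatible_nonarch_abs w \<and> \<not> trivial_abs w \<and> valued_extension v w h)"

lemma trop_points_seminorm:
  fixes \<phi> :: "('k::real_closed_field, 'n::finite) dual \<Rightarrow> real"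
  assumes data: "tropical_data v w h" and \<phi>: "\<phi> \<in> trop_points v w h"
  shows "signed_seminorm v dual_scale \<phi>"
proof (cases "trivial_abs v")
  case True
  then have w: "compatible_nonarch_abs w" and h: "valued_extension v w h"
    using data unfolding tropical_data_def by blast+
  obtain x where \<phi>: "\<phi> = (\<lambda>f. signed_abs w (dual_apply (dual_base_change h f) x))"
    using \<phi> True unfolding trop_points_def by auto
  have add: "dual_apply (dual_base_change h (f + g)) x =
      dual_apply (dual_base_change h f) x + dual_apply (dual_base_change h g) x" for f g
    unfolding dual_base_change_coeffs
    by (simp add: dual_coeffs_def dual_apply_add valued_extension_signed_abs[OF h] functional_of_add)
  have scale:
      "dual_apply (dual_base_change h (dual_scale c f)) x = h c * dual_apply (dual_base_change h f) x"
    for c f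
    unfolding dual_base_change_coeffs
    by (simp add: dual_coeffs_def dual_apply_scale valued_extension_signed_abs[OF h] functional_of_scale)
  show ?thesis
    using signed_abs_seminorm[OF w] valued_extension_signed_abs(6)[OF h]
    unfolding signed_seminorm_def \<phi> add scale signed_abs_mult[OF w] by (simp add: signed_abs_def)
next
  case False
  then obtain x where \<phi>: "\<phi> = (\<lambda>f. signed_abs v (dual_apply f x))"
    using \<phi> unfolding trop_points_def by auto
  have v: "compatible_nonarch_abs v" using data unfolding tropical_data_def by blast
  show ?thesis
    using signed_abs_seminorm[OF v] unfolding signed_seminorm_def \<phi> dual_apply_add dual_apply_scale
    by blast
qed

lemma trop_points_approximate:
  fixes N :: "('k::real_closed_field, 'n::finite) dual \<Rightarrow> real"
  assumes data: "tropical_data v w h" and N: "signed_seminorm v dual_scale N" and "finite F" "0 < \<epsilon>"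
  obtains \<phi> where "\<phi> \<in> trop_points v w h" "\<And>f. f \<in> F \<Longrightarrow> \<bar>\<phi> f - N f\<bar> < \<epsilon>"
proof (cases "trivial_abs v")
  case True
  have *: "compatible_nonarch_abs v" "compatible_nonarch_abs w" "\<not> trivial_abs w"
      "valued_extension v w h"
    using data True unfolding tropical_data_def by blast+
  obtain x where "\<And>f. f \<in> F \<Longrightarrow> \<bar>signed_abs w (dual_apply (dual_base_change h f) x) - N f\<bar> < \<epsilon>"
    using approximation_trivial[OF *(1) True *(2-4) N assms(3,4)] by blast
  then show ?thesis using that[of "\<lambda>f. signed_abs w (dual_apply (dual_base_change h f) x)"] True
    unfolding trop_points_def by auto
next
  case False
  have "compatible_nonarch_abs v" using data unfolding tropical_data_def by blast
  then obtain x where "\<And>f. f \<in> F \<Longrightarrow> \<bar>signed_abs v (dual_apply f x) - N f\<bar> < \<epsilon>"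
    using approximation_nontrivial[OF _ False N assms(3,4)] by blast
  then show ?thesis using that[of "\<lambda>f. signed_abs v (dual_apply f x)"] False
    unfolding trop_points_def by auto
qed

abbreviation RP_cone :: "nat \<Rightarrow> (nat \<Rightarrow> real) topology" where
  "RP_cone m \<equiv> subtopology (Euclidean_space (Suc m)) (- {0})"

lemma topspace_RP_cone: "topspace (RP_cone m) = tuples m - {0}"
  by (auto simp: topspace_Euclidean_space tuples_def Suc_le_eq)

lemma RP_cone_eq: "RP_cone m = subtopology (powertop_real UNIV) (tuples m - {0})"
  unfolding Euclidean_space_def subtopology_subtopology
  by (rule arg_cong2[where f = subtopology]) (auto simp: tuples_def Suc_le_eq)

lemma topspace_RP: "topspace (RP_topology m) = proj_space m"
  unfolding RP_topology_def topspace_quotient_topology topspace_RP_cone projectivization_def ..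

lemma continuous_proj_class: "continuous_map (RP_cone m) (RP_topology m) proj_class"
  unfolding RP_topology_def by (rule quotient_imp_continuous_map[OF quotient_map_quotient_topology])

text \<open>
  Tuples that vanish identically are discarded: they do not represent points of projective space.
\<close>
lemma Trop_r_emb_class:
  fixes f :: "nat \<Rightarrow> ('k::real_closed_field, 'n::finite) dual"
    and w :: "'l::real_closed_field \<Rightarrow> real"
  assumes data: "tropical_data v w h" and f: "f \<in> tuples m"
  shows "Trop_r v w h m (emb_class f) =
    RP_topology m closure_of (proj_class ` ((\<lambda>\<phi> i. \<phi> (f i)) ` trop_points v w h - {0}))"
proof -
  let ?T = "(\<lambda>\<phi> i. \<phi> (f i)) ` trop_points v w h"
  let ?R = "{proj_class (\<lambda>i. signed_abs w (dual_apply (dual_base_change h (f i)) x)) |x. x \<noteq> 0}"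
  let ?S = "{proj_class (\<lambda>i. signed_abs v (dual_apply (f i) x)) |x. x \<noteq> 0}"
  have v: "compatible_nonarch_abs v" using data unfolding tropical_data_def by blast
  have tup: "t \<in> tuples m" if "t \<in> ?T" for t
  proof -
    obtain \<phi> where \<phi>: "\<phi> \<in> trop_points v w h" "t = (\<lambda>i. \<phi> (f i))" using \<open>t \<in> ?T\<close> by blast
    interpret signed_seminormed dual_scale v \<phi>
      by (rule signed_seminormed_dual[OF v trop_points_seminorm[OF data \<phi>(1)]])
    show ?thesis using f \<phi>(2) by (simp add: tuples_def)
  qed
  have restrict: "topspace (RP_topology m) \<inter> (proj_class ` (?T - {0})) = proj_class ` (?T - {0})"
    using tup by (auto simp: topspace_RP proj_space_class)
  show ?thesis
  proof (cases "trivial_abs v")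
    case True
    have w: "compatible_nonarch_abs w" and h: "valued_extension v w h"
      using data True unfolding tropical_data_def by blast+
    have "trop_r w ` emb_map (emb_base_change h (emb_class f)) ` vec_proj_space = ?R"
      using h unfolding valued_extension_def
      by (simp only: image_image) (simp add: emb_base_change_class vec_proj_space_image emb_map_class trop_r_class[OF w])
    moreover have eq: "topspace (RP_topology m) \<inter> ?R = proj_class ` (?T - {0})"
    proof (intro equalityI subsetI)
      fix p assume "p \<in> topspace (RP_topology m) \<inter> ?R"
      then obtain x where x:
          "p = proj_class (\<lambda>i. signed_abs w (dual_apply (dual_base_change h (f i)) x))"
          "(\<lambda>i. signed_abs w (dual_apply (dual_base_change h (f i)) x)) \<noteq> 0"
        by (auto simp: topspace_RP proj_space_class)
      have "(\<lambda>i. signed_abs w (dual_apply (dual_base_change h (f i)) x)) \<in> ?T"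
        using True
        by (intro image_eqI[of _ _ "\<lambda>g. signed_abs w (dual_apply (dual_base_change h g) x)"]) (auto simp: trop_points_def)
      then show "p \<in> proj_class ` (?T - {0})" using x by blast
    next
      fix p assume p: "p \<in> proj_class ` (?T - {0})"
      then obtain t where t: "t \<in> ?T" "t \<noteq> 0" "p = proj_class t" by blast
      then obtain x where x: "t = (\<lambda>i. signed_abs w (dual_apply (dual_base_change h (f i)) x))"
        using True by (auto simp: trop_points_def)
      have "x \<noteq> 0"
      proof
        assume "x = 0"
        moreover have "dual_apply g 0 = 0" for g :: "('l, 'n) dual"
          using dual_apply_vec(2)[of g 0 0] by simp
        ultimately show False using t(2) x by (simp add: fun_eq_iff signed_abs_zero[OF w])
      qed
      then show "p \<in> topspace (RP_topology m) \<inter> ?R"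
        using t x tup by (auto simp: topspace_RP proj_space_class)
    qed
    moreover have "RP_topology m closure_of ?R = RP_topology m closure_of (proj_class ` (?T - {0}))"
      by (subst closure_of_restrict) (simp only: eq)
    ultimately show ?thesis using True unfolding Trop_r_def by simp
  next
    case False
    have "trop_r v ` emb_map (emb_class f) ` vec_proj_space = ?S"
      by (simp only: image_image) (simp add: vec_proj_space_image emb_map_class trop_r_class[OF v])
    moreover have eq: "topspace (RP_topology m) \<inter> ?S = proj_class ` (?T - {0})"
    proof (intro equalityI subsetI)
      fix p assume "p \<in> topspace (RP_topology m) \<inter> ?S"
      then obtain x where x: "p = proj_class (\<lambda>i. signed_abs v (dual_apply (f i) x))"
          "(\<lambda>i. signed_abs v (dual_apply (f i) x)) \<noteq> 0"
        by (auto simp: topspace_RP proj_space_class)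
      have "(\<lambda>i. signed_abs v (dual_apply (f i) x)) \<in> ?T"
        using False
        by (intro image_eqI[of _ _ "\<lambda>g. signed_abs v (dual_apply g x)"]) (auto simp: trop_points_def)
      then show "p \<in> proj_class ` (?T - {0})" using x by blast
    next
      fix p assume p: "p \<in> proj_class ` (?T - {0})"
      then obtain t where t: "t \<in> ?T" "t \<noteq> 0" "p = proj_class t" by blast
      then obtain x where x: "t = (\<lambda>i. signed_abs v (dual_apply (f i) x))"
        using False by (auto simp: trop_points_def)
      have "x \<noteq> 0"
      proof
        assume "x = 0"
        moreover have "dual_apply g 0 = 0" for g :: "('k, 'n) dual"
          using dual_apply_vec(2)[of g 0 0] by simp
        ultimately show False using t(2) x by (simp add: fun_eq_iff signed_abs_zero[OF v])
      qed
      then show "p \<in> topspace (RP_topology m) \<inter> ?S"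
        using t x tup by (auto simp: topspace_RP proj_space_class)
    qed
    moreover have "RP_topology m closure_of ?S = RP_topology m closure_of (proj_class ` (?T - {0}))"
      by (subst closure_of_restrict) (simp only: eq)
    ultimately show ?thesis using False unfolding Trop_r_def by simp
  qed
qed

text \<open>
  A sequence of points approximating \<open>N\<close> on the finitely many functionals of the tuple converges
  coordinatewise, and the quotient map preserves limits. The error is kept below a nonzero value
  \<open>\<bar>N (f k)\<bar>\<close>, so that the approximating tuples are nonzero.
\<close>
lemma seminorm_in_Trop_r:
  fixes f :: "nat \<Rightarrow> ('k::real_closed_field, 'n::finite) dual"
  assumes data: "tropical_data v w h" and f: "f \<in> tuples m"
    and N: "signed_seminorm v dual_scale N" and nz: "(\<lambda>i. N (f i)) \<noteq> 0"
  shows "proj_class (\<lambda>i. N (f i)) \<in> Trop_r v w h m (emb_class f)"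
proof -
  have v: "compatible_nonarch_abs v" using data unfolding tropical_data_def by blast
  interpret N: signed_seminormed dual_scale v N by (rule signed_seminormed_dual[OF v N])
  let ?T = "(\<lambda>\<phi> i. \<phi> (f i)) ` trop_points v w h"
  obtain k where k: "N (f k) \<noteq> 0" using nz by (auto simp: fun_eq_iff)
  have "k \<le> m"
  proof (rule ccontr)
    assume "\<not> k \<le> m"
    then have "f k = 0" using f by (simp add: tuples_def)
    then show False using k by simp
  qed
  have "\<exists>\<phi>. \<phi> \<in> trop_points v w h \<and> (\<forall>i\<le>m. \<bar>\<phi> (f i) - N (f i)\<bar> < min \<bar>N (f k)\<bar> (inverse (real (Suc j))))"
    for j
  proof -
    have "0 < min \<bar>N (f k)\<bar> (inverse (real (Suc j)))" using k by simp
    then obtain \<phi> where "\<phi> \<in> trop_points v w h"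
      "\<And>g. g \<in> f ` {..m} \<Longrightarrow> \<bar>\<phi> g - N g\<bar> < min \<bar>N (f k)\<bar> (inverse (real (Suc j)))"
      using trop_points_approximate[OF data N, of "f ` {..m}"] by blast
    then show ?thesis by (metis atMost_iff imageI)
  qed
  then obtain \<phi> where \<phi>: "\<And>j. \<phi> j \<in> trop_points v w h"
    "\<And>i j. i \<le> m \<Longrightarrow> \<bar>\<phi> j (f i) - N (f i)\<bar> < min \<bar>N (f k)\<bar> (inverse (real (Suc j)))"
    using choice[of "\<lambda>j \<phi>. \<phi> \<in> trop_points v w h \<and>
      (\<forall>i\<le>m. \<bar>\<phi> (f i) - N (f i)\<bar> < min \<bar>N (f k)\<bar> (inverse (real (Suc j))))"] by blast
  have beyond: "\<phi> j (f i) = 0" "N (f i) = 0" if "\<not> i \<le> m" for i j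
  proof -
    interpret signed_seminormed dual_scale v "\<phi> j"
      by (rule signed_seminormed_dual[OF v trop_points_seminorm[OF data \<phi>(1)]])
    show "\<phi> j (f i) = 0" "N (f i) = 0" using f that by (auto simp: tuples_def)
  qed
  have mem: "(\<lambda>i. \<phi> j (f i)) \<in> (tuples m - {0}) \<inter> (?T - {0})" for j
    using \<phi>(1)[of j] \<phi>(2)[OF \<open>k \<le> m\<close>, of j] beyond by (fastforce simp: fun_eq_iff tuples_def)
  have lim: "(\<lambda>j. \<phi> j (f i)) \<longlonglongrightarrow> N (f i)" for i
  proof (cases "i \<le> m")
    case True
    have "(\<lambda>j. \<phi> j (f i) - N (f i)) \<longlonglongrightarrow> 0"
    proof (rule Lim_null_comparison)
      show "\<forall>\<^sub>F j in sequentially. norm (\<phi> j (f i) - N (f i)) \<le> inverse (real (Suc j))"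
        using \<phi>(2)[OF True] by (intro always_eventually) (auto simp: less_imp_le)
    qed (rule LIMSEQ_inverse_real_of_nat)
    then show ?thesis by (simp add: LIM_zero_iff)
  qed (simp add: beyond)
  have "(\<lambda>i. N (f i)) \<in> powertop_real UNIV closure_of ((tuples m - {0}) \<inter> (?T - {0}))"
  proof (rule limitin_closedin)
    show "limitin (powertop_real UNIV) (\<lambda>j i. \<phi> j (f i)) (\<lambda>i. N (f i)) sequentially"
      unfolding limitin_componentwise using lim by simp
    show "\<forall>\<^sub>F j in sequentially. (\<lambda>i. \<phi> j (f i)) \<in> powertop_real UNIV closure_of ((tuples m - {0}) \<inter> (?T - {0}))"
      using mem closure_of_subset[of "(tuples m - {0}) \<inter> (?T - {0})" "powertop_real UNIV"]
      by (intro always_eventually) auto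
  qed simp_all
  moreover have "(\<lambda>i. N (f i)) \<in> tuples m - {0}" using nz beyond by (auto simp: tuples_def)
  ultimately have "(\<lambda>i. N (f i)) \<in> RP_cone m closure_of (?T - {0})"
    unfolding RP_cone_eq closure_of_subtopology by blast
  then show ?thesis unfolding Trop_r_emb_class[OF data f]
    using continuous_map_image_closure_subset[OF continuous_proj_class] by blast
qed

lemma openin_RP_topologyI:
  assumes "open U" and scale: "\<And>c x. c \<noteq> 0 \<Longrightarrow> x \<in> U \<Longrightarrow> (\<lambda>i. c * x i) \<in> U"
  shows "openin (RP_topology m) (proj_class ` ((tuples m - {0}) \<inter> U))"
  unfolding RP_topology_def openin_quotient_topology
proof
  have "{x \<in> topspace (RP_cone m). proj_class x \<in> proj_class ` ((tuples m - {0}) \<inter> U)} = (tuples m - {0}) \<inter> U"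
    unfolding topspace_RP_cone using scale by (auto dest!: proj_class_eqD)
  moreover have "openin (RP_cone m) ((tuples m - {0}) \<inter> U)"
    unfolding RP_cone_eq openin_subtopology using assms(1)
    by (metis Int_commute euclidean_product_topology open_openin)
  ultimately show
      "openin (RP_cone m) {x \<in> topspace (RP_cone m). proj_class x \<in> proj_class ` ((tuples m - {0}) \<inter> U)}"
    by simp
qed (unfold topspace_RP_cone, blast)

text \<open>
  How closed relations reach the boundary: if the condition failed at a point of the closure, it
  would fail on an open cone, and this cone would contain the tuple of a signed seminorm.
\<close>
lemma Trop_r_closed_condition:
  fixes f :: "nat \<Rightarrow> ('k::real_closed_field, 'n::finite) dual"
  assumes data: "tropical_data v w h" and f: "f \<in> tuples m"
    and C: "closed C" "\<And>c x. c \<noteq> 0 \<Longrightarrow> x \<in> C \<Longrightarrow> (\<lambda>i. c * x i) \<in> C"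
    and holds: "\<And>\<phi>. signed_seminorm v dual_scale \<phi> \<Longrightarrow> (\<lambda>i. \<phi> (f i)) \<in> C"
    and p: "p \<in> Trop_r v w h m (emb_class f)" "y \<in> p"
  shows "y \<in> C"
proof (rule ccontr)
  assume "y \<notin> C"
  let ?U = "proj_class ` ((tuples m - {0}) \<inter> - C)"
  have p': "p \<in> RP_topology m closure_of (proj_class ` ((\<lambda>\<phi> i. \<phi> (f i)) ` trop_points v w h - {0}))"
    using p(1) unfolding Trop_r_emb_class[OF data f] .
  then have "p \<in> proj_space m" by (metis closure_of_subset_topspace subsetD topspace_RP)
  then obtain x where x: "x \<in> tuples m" "x \<noteq> 0" "p = proj_class x" by (rule proj_spaceE)
  have "p = proj_class y" using p(2) x(3) proj_class_eqI by blast
  then have "proj_class y \<in> proj_space m" using \<open>p \<in> proj_space m\<close> by simp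
  then have y: "y \<in> tuples m - {0}" unfolding proj_space_class by simp
  have C': "x \<in> C" if "c \<noteq> 0" "(\<lambda>i. c * x i) \<in> C" for c x
    using C(2)[of "inverse c" "\<lambda>i. c * x i"] that by (simp flip: mult.assoc)
  have "openin (RP_topology m) ?U"
  proof (rule openin_RP_topologyI)
    show "open (- C)" using C(1) by (simp add: open_Compl)
    show "(\<lambda>i. c * x i) \<in> - C" if "c \<noteq> 0" "x \<in> - C" for c x using C'[OF that(1), of x] that(2)
      by blast
  qed
  moreover have "p \<in> ?U" using y \<open>y \<notin> C\<close> \<open>p = proj_class y\<close> by blast
  ultimately obtain q where q: "q \<in> proj_class ` ((\<lambda>\<phi> i. \<phi> (f i)) ` trop_points v w h - {0})"
      "q \<in> ?U"
    using p'[unfolded in_closure_of, THEN conjunct2, rule_format, of ?U] by metis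
  obtain \<phi> where \<phi>: "\<phi> \<in> trop_points v w h" "q = proj_class (\<lambda>i. \<phi> (f i))"
    using q(1) by auto
  obtain z where z: "z \<notin> C" "q = proj_class z" using q(2) by auto
  have "proj_class (\<lambda>i. \<phi> (f i)) = proj_class z" using \<phi>(2) z(2) by simp
  then obtain c where "c \<noteq> 0" "(\<lambda>i. \<phi> (f i)) = (\<lambda>i. c * z i)" using proj_class_eqD by blast
  then have "(\<lambda>i. c * z i) \<in> C" using holds[OF trop_points_seminorm[OF data \<phi>(1)]] by simp
  then show False using C'[OF \<open>c \<noteq> 0\<close>] z(1) by blast
qed

section \<open>Torus-invariant open sets\<close>

text \<open>
  Allowing an arbitrary index set and repeated exponents makes products and pullbacks of forms
  immediate; coefficients of equal exponents are collected here once.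
\<close>
lemma homogeneous_formI:
  fixes c :: "'a \<Rightarrow> 'k::field"
  assumes "finite A" "\<And>a. a \<in> A \<Longrightarrow> (\<Sum>i\<le>m. e a i) = d"
    and F: "F = (\<lambda>x. \<Sum>a\<in>A. c a * (\<Prod>i\<le>m. x i ^ e a i))"
  shows "homogeneous_form m F"
proof -
  define b where "b \<beta> = (\<Sum>a\<in>{a \<in> A. e a = \<beta>}. c a)" for \<beta>
  have "F x = (\<Sum>\<beta>\<in>e ` A. b \<beta> * (\<Prod>i\<le>m. x i ^ \<beta> i))" for x
    unfolding F b_def by (subst sum.image_gen[OF \<open>finite A\<close>, of _ e])
      (auto intro!: sum.cong simp: sum_distrib_right)
  then have "F = (\<lambda>x. \<Sum>\<beta>\<in>e ` A. b \<beta> * (\<Prod>i\<le>m. x i ^ \<beta> i))" by blast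
  then show ?thesis unfolding homogeneous_form_def using assms(1,2)
    by (intro exI[of _ d] exI[of _ "e ` A"] exI[of _ b]) auto
qed

lemma homogeneous_form_mult:
  assumes "homogeneous_form m F" "homogeneous_form m G"
  shows "homogeneous_form m (\<lambda>x. F x * G x)"
proof -
  obtain d A c where F: "finite A" "\<forall>\<alpha>\<in>A. (\<Sum>i\<le>m. \<alpha> i) = d" "F = (\<lambda>x. \<Sum>\<alpha>\<in>A. c \<alpha> * (\<Prod>i\<le>m. x i ^ \<alpha> i))"
    using assms(1) unfolding homogeneous_form_def by blast
  obtain d' B c' where G: "finite B" "\<forall>\<alpha>\<in>B. (\<Sum>i\<le>m. \<alpha> i) = d'"
      "G = (\<lambda>x. \<Sum>\<alpha>\<in>B. c' \<alpha> * (\<Prod>i\<le>m. x i ^ \<alpha> i))"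
    using assms(2) unfolding homogeneous_form_def by blast
  show ?thesis
  proof (rule homogeneous_formI)
    show "finite (A \<times> B)" using F(1) G(1) by simp
    show "(\<Sum>i\<le>m. fst a i + snd a i) = d + d'" if "a \<in> A \<times> B" for a
      using that F(2) G(2) by (auto simp: sum.distrib)
    show "(\<lambda>x. F x * G x) = (\<lambda>x. \<Sum>a\<in>A \<times> B. (c (fst a) * c' (snd a)) * (\<Prod>i\<le>m. x i ^ (fst a i + snd a i)))"
      unfolding F(3) G(3) sum_product sum.cartesian_product
      by (intro ext sum.cong) (auto simp: power_add prod.distrib)
  qed
qed

lemma homogeneous_form_coordinate:
  assumes "k \<le> m"
  shows "homogeneous_form m (\<lambda>x. x k :: 'k::field)"
proof (rule homogeneous_formI[where A = "{()}" and e = "\<lambda>_ i. if i = k then 1 else 0" and d = 1 and c = "\<lambda>_. 1"])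
  have "(\<Prod>i\<le>m. x i ^ (if i = k then 1 else 0)) = x k" for x :: "nat \<Rightarrow> 'k::field"
  proof -
    have "(\<Prod>i\<le>m. x i ^ (if i = k then 1 else 0)) = (\<Prod>i\<le>m. if i = k then x i else 1)"
      by (intro prod.cong) auto
    then show ?thesis using assms by simp
  qed
  then show "(\<lambda>x. x k) = (\<lambda>x. \<Sum>a\<in>{()}. 1 * (\<Prod>i\<le>m. (x i :: 'k::field) ^ (if i = k then 1 else 0)))"
    by simp
qed (use assms in auto)

lemma homogeneous_form_one: "homogeneous_form m (\<lambda>x. 1)"
  by (rule homogeneous_formI[where A = "{()}" and e = "\<lambda>_ _. 0" and d = 0 and c = "\<lambda>_. 1"]) auto

lemma homogeneous_form_pullback:
  fixes F :: "(nat \<Rightarrow> 'k::field) \<Rightarrow> 'k"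
  assumes F: "homogeneous_form m F" and \<sigma>: "inj_on \<sigma> {..m}" "\<sigma> ` {..m} \<subseteq> {..m'}"
  shows "homogeneous_form m' (\<lambda>x. F (\<lambda>j. if j \<le> m then x (\<sigma> j) else 0))"
proof -
  obtain d A c where F: "finite A" "\<forall>\<alpha>\<in>A. (\<Sum>i\<le>m. \<alpha> i) = d" "F = (\<lambda>x. \<Sum>\<alpha>\<in>A. c \<alpha> * (\<Prod>i\<le>m. x i ^ \<alpha> i))"
    using F unfolding homogeneous_form_def by blast
  define e where "e \<alpha> l = (if l \<in> \<sigma> ` {..m} then \<alpha> (inv_into {..m} \<sigma> l) else 0)" for \<alpha> ::
      "nat \<Rightarrow> nat" and l
  show ?thesis
  proof (rule homogeneous_formI[OF F(1)])
    show "(\<Sum>l\<le>m'. e \<alpha> l) = d" if "\<alpha> \<in> A" for \<alpha>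
    proof -
      have "(\<Sum>l\<le>m'. e \<alpha> l) = (\<Sum>l\<in>\<sigma> ` {..m}. e \<alpha> l)"
        using \<sigma>(2) by (intro sum.mono_neutral_right) (auto simp: e_def)
      also have "\<dots> = (\<Sum>i\<le>m. \<alpha> i)"
        using \<sigma>(1) by (simp add: sum.reindex e_def)
      finally show ?thesis using F(2) that by simp
    qed
    have "(\<Prod>l\<le>m'. x l ^ e \<alpha> l) = (\<Prod>i\<le>m. (if i \<le> m then x (\<sigma> i) else 0) ^ \<alpha> i)"
      for x :: "nat \<Rightarrow> 'k" and \<alpha>
    proof -
      have "(\<Prod>l\<le>m'. x l ^ e \<alpha> l) = (\<Prod>l\<in>\<sigma> ` {..m}. x l ^ e \<alpha> l)"
        using \<sigma>(2) by (intro prod.mono_neutral_right) (auto simp: e_def)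
      also have "\<dots> = (\<Prod>i\<le>m. x (\<sigma> i) ^ \<alpha> i)"
        using \<sigma>(1) by (simp add: prod.reindex e_def)
      finally show ?thesis by simp
    qed
    then show "(\<lambda>x. F (\<lambda>j. if j \<le> m then x (\<sigma> j) else 0)) = (\<lambda>x. \<Sum>\<alpha>\<in>A. c \<alpha> * (\<Prod>l\<le>m'. x l ^ e \<alpha> l))"
      unfolding F(3) by (simp only:)
  qed
qed

lemma homogeneous_form_nonzero_scale:
  assumes "homogeneous_form m F" "c \<noteq> 0"
  shows "F (\<lambda>i. c * x i) = 0 \<longleftrightarrow> F x = 0"
proof -
  obtain d A b where F: "finite A" "\<forall>\<alpha>\<in>A. (\<Sum>i\<le>m. \<alpha> i) = d" "F = (\<lambda>x. \<Sum>\<alpha>\<in>A. b \<alpha> * (\<Prod>i\<le>m. x i ^ \<alpha> i))"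
    using assms(1) unfolding homogeneous_form_def by blast
  have "(\<Prod>i\<le>m. (c * x i) ^ \<alpha> i) = c ^ d * (\<Prod>i\<le>m. x i ^ \<alpha> i)" if "\<alpha> \<in> A" for \<alpha>
    using F(2) that by (simp add: power_mult_distrib prod.distrib flip: power_sum)
  then have "F (\<lambda>i. c * x i) = c ^ d * F x"
    unfolding F(3) sum_distrib_left by (intro sum.cong) (auto simp: mult_ac)
  then show ?thesis using assms(2) by simp
qed

lemma homogeneous_form_nonzero_class:
  assumes "homogeneous_form m F"
  shows "(\<exists>y\<in>proj_class x. F y \<noteq> 0) \<longleftrightarrow> F x \<noteq> 0"
proof
  assume "\<exists>y\<in>proj_class x. F y \<noteq> 0"
  then obtain c where "c \<noteq> 0" "F (\<lambda>i. c * x i) \<noteq> 0" by (auto simp: mem_proj_class)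
  then show "F x \<noteq> 0" using homogeneous_form_nonzero_scale[OF assms] by simp
qed (use proj_class_self in blast)

lemma zariski_openE:
  assumes "zariski_open m U"
  obtains S where "\<And>F. F \<in> S \<Longrightarrow> homogeneous_form m F" "U \<subseteq> proj_space m"
    "\<And>x. proj_class x \<in> U \<longleftrightarrow> x \<in> tuples m \<and> x \<noteq> 0 \<and> (\<exists>F\<in>S. F x \<noteq> 0)"
proof -
  obtain S where S: "\<forall>F\<in>S. homogeneous_form m F" "U = {p \<in> proj_space m. \<exists>F\<in>S. \<exists>x\<in>p. F x \<noteq> 0}"
    using assms unfolding zariski_open_def by blast
  have "(\<exists>y\<in>proj_class x. F y \<noteq> 0) \<longleftrightarrow> F x \<noteq> 0" if "F \<in> S" for F x
    using S(1) that by (intro homogeneous_form_nonzero_class) blast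
  then show ?thesis using that[of S] S unfolding proj_space_class[symmetric]
    by (auto simp: proj_space_class)
qed

lemma zariski_openI:
  assumes S: "\<And>F. F \<in> S \<Longrightarrow> homogeneous_form m F" and U: "U \<subseteq> proj_space m"
    and mem: "\<And>x. proj_class x \<in> U \<longleftrightarrow> x \<in> tuples m \<and> x \<noteq> 0 \<and> (\<exists>F\<in>S. F x \<noteq> 0)"
  shows "zariski_open m U"
proof -
  have *: "(\<exists>y\<in>proj_class x. F y \<noteq> 0) \<longleftrightarrow> F x \<noteq> 0" if "F \<in> S" for F x
    using S that by (intro homogeneous_form_nonzero_class) blast
  have "p \<in> U \<longleftrightarrow> p \<in> proj_space m \<and> (\<exists>F\<in>S. \<exists>x\<in>p. F x \<noteq> 0)" for p
  proof (cases "p \<in> proj_space m")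
    case True
    then obtain x where x: "x \<in> tuples m" "x \<noteq> 0" "p = proj_class x" by (rule proj_spaceE)
    show ?thesis unfolding x(3) mem using * x by (auto simp: proj_space_class)
  qed (use U in auto)
  then have "U = {p \<in> proj_space m. \<exists>F\<in>S. \<exists>x\<in>p. F x \<noteq> 0}"
    by (simp only: set_eq_iff mem_Collect_eq) simp
  then show ?thesis unfolding zariski_open_def using S by (intro exI[of _ S] conjI ballI)
qed

lemma zariski_open_proj_space: "zariski_open m (proj_space m)"
  by (rule zariski_openI[of "{\<lambda>x. 1}"]) (auto simp: homogeneous_form_one proj_space_class)

lemma zariski_open_Int:
  assumes "zariski_open m U" "zariski_open m V"
  shows "zariski_open m (U \<inter> V)"
proof -
  obtain S where S: "\<And>F. F \<in> S \<Longrightarrow> homogeneous_form m F" "U \<subseteq> proj_space m"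
    "\<And>x. proj_class x \<in> U \<longleftrightarrow> x \<in> tuples m \<and> x \<noteq> 0 \<and> (\<exists>F\<in>S. F x \<noteq> 0)"
    by (rule zariski_openE[OF assms(1)]) blast
  obtain T where T: "\<And>F. F \<in> T \<Longrightarrow> homogeneous_form m F"
    "\<And>x. proj_class x \<in> V \<longleftrightarrow> x \<in> tuples m \<and> x \<noteq> 0 \<and> (\<exists>F\<in>T. F x \<noteq> 0)"
    by (rule zariski_openE[OF assms(2)]) blast
  show ?thesis
  proof (rule zariski_openI)
    show "homogeneous_form m F" if "F \<in> (\<lambda>(G, H) x. G x * H x) ` (S \<times> T)" for F
      using that S(1) T(1) by (auto intro: homogeneous_form_mult)
    show "proj_class x \<in> U \<inter> V \<longleftrightarrow> x \<in> tuples m \<and> x \<noteq> 0 \<and> (\<exists>F\<in>(\<lambda>(G, H) x. G x * H x) ` (S \<times> T). F x \<noteq> 0)"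
      for x
      unfolding Int_iff S(3) T(2) by auto
  qed (use S(2) in blast)
qed

lemma restricted_tuple: "(\<lambda>j. if j \<le> m then x j else 0) \<in> tuples m"
  by (simp add: tuples_def)

text \<open>
  The forms \<open>F\<close> defining \<open>U\<close> may be constant, so each pullback is multiplied by the coordinates
  \<open>x (\<sigma> k)\<close>; this excludes the points where the coordinate map is undefined.
\<close>
lemma zariski_open_pullback:
  assumes U: "zariski_open m U" and \<sigma>: "inj_on \<sigma> {..m}" "\<sigma> ` {..m} \<subseteq> {..m'}"
  shows "zariski_open m' {p \<in> proj_space m'. coord_map m \<sigma> p \<in> U}"
proof -
  obtain S where S: "\<And>F. F \<in> S \<Longrightarrow> homogeneous_form m F"
    "\<And>x. proj_class x \<in> U \<longleftrightarrow> x \<in> tuples m \<and> x \<noteq> 0 \<and> (\<exists>F\<in>S. F x \<noteq> 0)"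
    by (rule zariski_openE[OF U]) blast
  let ?T = "(\<lambda>(k, F) x. x (\<sigma> k) * F (\<lambda>j. if j \<le> m then x (\<sigma> j) else 0)) ` ({..m} \<times> S)"
  show ?thesis
  proof (rule zariski_openI)
    show "homogeneous_form m' F" if "F \<in> ?T" for F
      using that S(1) \<sigma>
      by (auto intro!: homogeneous_form_mult homogeneous_form_coordinate homogeneous_form_pullback)
    show "proj_class x \<in> {p \<in> proj_space m'. coord_map m \<sigma> p \<in> U} \<longleftrightarrow>
        x \<in> tuples m' \<and> x \<noteq> 0 \<and> (\<exists>F\<in>?T. F x \<noteq> 0)" for x
      unfolding mem_Collect_eq coord_map_class S(2) proj_space_class
      using restricted_tuple[of m "\<lambda>j. x (\<sigma> j)"] by (auto simp: fun_eq_iff)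
  qed blast
qed

lemma torus_action_class:
  "(\<lambda>x i. t i * x i) ` proj_class y = proj_class (\<lambda>i. t i * (y i :: 'k::field))"
  unfolding scalar_class_def pointwise_scale_def by (force simp: mult.left_commute)

lemma torus_action_proj_space:
  assumes "\<forall>i\<le>m. t i \<noteq> (0 :: 'k::field)" "p \<in> proj_space m"
  shows "(\<lambda>x i. t i * x i) ` p \<in> proj_space m"
proof -
  obtain x where x: "x \<in> tuples m" "x \<noteq> 0" "p = proj_class x" using assms(2) by (rule proj_spaceE)
  then obtain i where "x i \<noteq> 0" by (auto simp: fun_eq_iff)
  moreover from this have "i \<le> m" using x(1) by (intro leI) (auto simp: tuples_def)
  ultimately show ?thesis using x assms(1)
    unfolding x(3) torus_action_class proj_space_class by (auto simp: tuples_def fun_eq_iff)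
qed

lemma torus_invariant_proj_space: "torus_invariant m (proj_space m)"
  unfolding torus_invariant_def using torus_action_proj_space by blast

lemma torus_invariant_pullback:
  fixes U :: "(nat \<Rightarrow> 'k::field) set set"
  assumes U: "torus_invariant m U" and \<sigma>: "\<sigma> ` {..m} \<subseteq> {..m'}"
  shows "torus_invariant m' {p \<in> proj_space m'. coord_map m \<sigma> p \<in> U}"
  unfolding torus_invariant_def
proof (intro allI impI ballI)
  fix t :: "nat \<Rightarrow> 'k" and p assume t: "\<forall>i\<le>m'. t i \<noteq> 0" and
      "p \<in> {p \<in> proj_space m'. coord_map m \<sigma> p \<in> U}"
  then have p: "p \<in> proj_space m'" "coord_map m \<sigma> p \<in> U" by auto
  from p(1) obtain x where x: "x \<in> tuples m'" "x \<noteq> 0" "p = proj_class x" by (rule proj_spaceE)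
  have "\<forall>i\<le>m. t (\<sigma> i) \<noteq> 0" using t \<sigma> by auto
  then have "(\<lambda>x i. t (\<sigma> i) * x i) ` coord_map m \<sigma> p \<in> U"
    using U p(2) unfolding torus_invariant_def by (elim allE[of _ "\<lambda>i. t (\<sigma> i)"]) blast
  moreover have "(\<lambda>x i. t (\<sigma> i) * x i) ` coord_map m \<sigma> p = coord_map m \<sigma> ((\<lambda>x i. t i * x i) ` p)"
    unfolding x(3) coord_map_class torus_action_class by (rule arg_cong[of _ _ proj_class]) auto
  ultimately show "(\<lambda>x i. t i * x i) ` p \<in> {p \<in> proj_space m'. coord_map m \<sigma> p \<in> U}"
    using torus_action_proj_space[OF t p(1)] by simp
qed

lemma torus_invariant_Int:
  "torus_invariant m U \<Longrightarrow> torus_invariant m V \<Longrightarrow> torus_invariant m (U \<inter> V)"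
  unfolding torus_invariant_def by blast

section \<open>Embeddings, their joins and their morphisms\<close>
lemma spanning_nonvanishing:
  fixes f :: "nat \<Rightarrow> ('k::field, 'n::finite) dual"
  assumes "dual.span (f ` {..m}) = UNIV" "x \<noteq> 0"
  obtains i where "i \<le> m" "dual_apply (f i) x \<noteq> 0"
proof (rule ccontr)
  assume *: "\<not> thesis"
  have "dual.subspace {g. dual_apply g x = 0}"
    unfolding dual.subspace_def by (simp add: dual_apply_zero dual_apply_add dual_apply_scale)
  moreover have "f ` {..m} \<subseteq> {g. dual_apply g x = 0}" using * that by blast
  ultimately have "dual.span (f ` {..m}) \<subseteq> {g. dual_apply g x = 0}" by (intro dual.span_minimal)
  then have "dual_apply g x = 0" for g using assms(1) by blast
  from this[of "functional_of (\<lambda>j. if j = i then 1 else 0)" for i] have "x $ i = 0" for i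
    by (simp add: functional_of.rep_eq if_distrib[of "\<lambda>a. a * _"] cong: if_cong)
  then show False using assms(2) by (simp add: vec_eq_iff)
qed

lemma spanning_seminorm_nonzero:
  fixes N :: "('k::linordered_field, 'n::finite) dual \<Rightarrow> real"
  assumes "compatible_nonarch_abs v" "signed_seminorm v dual_scale N" "N \<noteq> 0" "dual.span B = UNIV"
  obtains b where "b \<in> B" "N b \<noteq> 0"
proof (rule ccontr)
  assume *: "\<not> thesis"
  interpret signed_seminormed dual_scale v N by (rule signed_seminormed_dual[OF assms(1,2)])
  have "N (dual_scale c g) = 0" if "N g = 0" for c g using abs_scale[of c g] that by simp
  then have "dual.subspace {g. N g = 0}"
    unfolding dual.subspace_def by (simp add: add_nonneg)
  moreover have "B \<subseteq> {g. N g = 0}" using * that by blast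
  ultimately have "dual.span B \<subseteq> {g. N g = 0}" by (intro dual.span_minimal)
  then show False using assms(3,4) by (auto simp: fun_eq_iff)
qed

lemma objectE:
  fixes X :: "('k::field, 'n::finite) embedding"
  assumes "X \<in> objects"
  obtains f where "emb X = emb_class f" "f \<in> tuples (ambient_dim X)"
      "dual.span (f ` {..ambient_dim X}) = UNIV"
  using assms unfolding objects_def linear_embeddings_def by blast

lemma objectI:
  fixes f :: "nat \<Rightarrow> ('k::field, 'n::finite) dual"
  assumes "f \<in> tuples m" "dual.span (f ` {..m}) = UNIV" "zariski_open m U" "torus_invariant m U"
    "\<And>x. x \<noteq> 0 \<Longrightarrow> proj_class (\<lambda>i. dual_apply (f i) x) \<in> U"
  shows "\<lparr>ambient_dim = m, emb = emb_class f, nbhd = U\<rparr> \<in> objects"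
  unfolding objects_def using assms(1,2,3,4,5)
  by (auto simp: linear_embeddings_def vec_proj_space_image emb_map_class)

lemma object_points:
  fixes X :: "('k::field, 'n::finite) embedding"
  assumes "X \<in> objects" "emb X = emb_class f" "x \<noteq> 0"
  shows "proj_class (\<lambda>i. dual_apply (f i) x) \<in> nbhd X"
  using assms unfolding objects_def by (auto simp: vec_proj_space_image emb_map_class)

lemma embedding_point:
  fixes f :: "nat \<Rightarrow> ('k::field, 'n::finite) dual"
  assumes "f \<in> tuples m" "dual.span (f ` {..m}) = UNIV" "x \<noteq> 0"
  shows "proj_class (\<lambda>i. dual_apply (f i) x) \<in> proj_space m"
proof -
  obtain i where "dual_apply (f i) x \<noteq> 0" using spanning_nonvanishing[OF assms(2,3)] by blast
  then show ?thesis using assms(1) unfolding proj_space_class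
    by (auto simp: tuples_def dual_apply_zero fun_eq_iff)
qed

definition join_tuple :: "nat \<Rightarrow> (nat \<Rightarrow> 'a) \<Rightarrow> (nat \<Rightarrow> 'a) \<Rightarrow> nat \<Rightarrow> 'a" where
  "join_tuple m f g = (\<lambda>i. if i \<le> m then f i else g (i - Suc m))"

text \<open>
  A common refinement of two embeddings. Its neighbourhood is the intersection of the preimages of
  the two given neighbourhoods, the largest set that both projections map into them.
\<close>
lemma join_object:
  fixes X Y :: "('k::field, 'n::finite) embedding"
  assumes X: "X \<in> objects" "emb X = emb_class f" "f \<in> tuples (ambient_dim X)"
      "dual.span (f ` {..ambient_dim X}) = UNIV"
    and Y: "Y \<in> objects" "emb Y = emb_class g" "g \<in> tuples (ambient_dim Y)"
  obtains Z :: "('k, 'n) embedding" where "Z \<in> objects"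
      "ambient_dim Z = Suc (ambient_dim X + ambient_dim Y)"
    "emb Z = emb_class (join_tuple (ambient_dim X) f g)"
        "join_tuple (ambient_dim X) f g \<in> tuples (ambient_dim Z)"
    "is_morphism id Z X" "is_morphism (\<lambda>j. j + Suc (ambient_dim X)) Z Y"
proof -
  define m where "m = ambient_dim X"
  define m' where "m' = ambient_dim Y"
  define M where "M = Suc (m + m')"
  define k where "k = join_tuple m f g"
  define \<tau> where "\<tau> = (\<lambda>j. j + Suc m)"
  define U where
      "U = {p \<in> proj_space M. coord_map m id p \<in> nbhd X} \<inter> {p \<in> proj_space M. coord_map m' \<tau> p \<in> nbhd Y}"
  define Z where "Z = \<lparr>ambient_dim = M, emb = emb_class k, nbhd = U\<rparr>"
  have k: "k \<in> tuples M" using Y(3) by (auto simp: k_def join_tuple_def tuples_def M_def m'_def)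
  have "f ` {..m} \<subseteq> k ` {..M}" by (force simp: k_def join_tuple_def M_def)
  then have span: "dual.span (k ` {..M}) = UNIV"
    using dual.span_mono[of "f ` {..m}" "k ` {..M}"] X(4) by (auto simp: m_def)
  have id_inj: "inj_on id {..m}" "id ` {..m} \<subseteq> {..M}" and \<tau>: "inj_on \<tau> {..m'}" "\<tau> ` {..m'} \<subseteq> {..M}"
    by (auto simp: M_def \<tau>_def inj_on_def)
  have open_inv: "zariski_open m (nbhd X)" "torus_invariant m (nbhd X)" "zariski_open m' (nbhd Y)"
      "torus_invariant m' (nbhd Y)"
    using X(1) Y(1) by (auto simp: objects_def m_def m'_def)
  have projX:
      "coord_map m id (proj_class (\<lambda>i. dual_apply (k i) x)) = proj_class (\<lambda>i. dual_apply (f i) x)"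
    for x
    unfolding coord_map_class using X(3)
    by (intro arg_cong[of _ _ proj_class]) (auto simp: k_def join_tuple_def tuples_def m_def dual_apply_zero)
  have projY:
      "coord_map m' \<tau> (proj_class (\<lambda>i. dual_apply (k i) x)) = proj_class (\<lambda>i. dual_apply (g i) x)"
    for x
    unfolding coord_map_class using Y(3)
    by (intro arg_cong[of _ _ proj_class]) (auto simp: k_def join_tuple_def tuples_def m'_def \<tau>_def dual_apply_zero)
  have Z: "Z \<in> objects"
    unfolding Z_def
  proof (rule objectI[OF k span])
    show "zariski_open M U" unfolding U_def
      using open_inv id_inj \<tau> by (intro zariski_open_Int zariski_open_pullback)
    show "torus_invariant M U" unfolding U_def
      using open_inv id_inj \<tau> by (intro torus_invariant_Int torus_invariant_pullback)
    show "proj_class (\<lambda>i. dual_apply (k i) x) \<in> U" if "x \<noteq> 0" for x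
      unfolding U_def
          using embedding_point[OF k span that] object_points[OF X(1,2) that] object_points[OF Y(1,2) that]
      by (simp add: projX projY)
  qed
  have emb_mor: "coord_map l \<sigma> (emb_map (emb_class k) p) = emb_map (emb_class a) p"
    if proj:
        "\<And>x. coord_map l \<sigma> (proj_class (\<lambda>i. dual_apply (k i) x)) = proj_class (\<lambda>i. dual_apply (a i) x)"
      and p: "p \<in> vec_proj_space"
    for l \<sigma> a p
  proof -
    obtain x where "p = scalar_class (*s) x" using p unfolding projectivization_def by blast
    then show ?thesis using proj by (simp add: emb_map_class)
  qed
  have "is_morphism id Z X" "is_morphism \<tau> Z Y"
    unfolding is_morphism_def using id_inj \<tau> X(2) Y(2) emb_mor[OF projX] emb_mor[OF projY]
    by (auto simp: Z_def U_def simp flip: m_def m'_def)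
  then show ?thesis using that[of Z] Z k by (simp add: Z_def k_def \<tau>_def M_def m_def m'_def)
qed

definition tuple_of :: "'a::zero list \<Rightarrow> nat \<Rightarrow> 'a" where
  "tuple_of xs i = (if i < length xs then xs ! i else 0)"

text \<open>
  With all of projective space as neighbourhood, such an object receives a morphism from its join
  with any other object.
\<close>
definition list_object :: "('k::field, 'n::finite) dual list \<Rightarrow> ('k, 'n) embedding" where
  "list_object xs =
     \<lparr>ambient_dim = length xs - 1, emb = emb_class (tuple_of xs), nbhd = proj_space (length xs - 1)\<rparr>"

lemma list_object:
  fixes xs :: "('k::field, 'n::finite) dual list"
  assumes "dual.span (set xs) = UNIV"
  shows "xs \<noteq> []" "list_object xs \<in> objects" "tuple_of xs \<in> tuples (length xs - 1)"
    "dual.span (tuple_of xs ` {..length xs - 1}) = UNIV"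
proof -
  have "xs \<noteq> []"
  proof
    assume "xs = []"
    then have "functional_of (\<lambda>_. 1) = (0 :: ('k, 'n) dual)" using assms by auto
    then have "dual_apply (functional_of (\<lambda>_. 1) :: ('k, 'n) dual) (axis undefined 1) = 0"
      by (simp add: dual_apply_zero)
    then show False by (simp add: functional_of.rep_eq axis_def if_distrib cong: if_cong)
  qed
  then have "{..length xs - 1} = {..<length xs}" by (cases xs) auto
  then have im: "tuple_of xs ` {..length xs - 1} = set xs"
    by (auto simp: tuple_of_def set_conv_nth)
  show tup: "tuple_of xs \<in> tuples (length xs - 1)" using \<open>xs \<noteq> []\<close>
    by (auto simp: tuple_of_def tuples_def)
  show span: "dual.span (tuple_of xs ` {..length xs - 1}) = UNIV" using assms im by simp
  show "xs \<noteq> []" by fact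
  show "list_object xs \<in> objects"
    unfolding list_object_def
    by (intro objectI tup span zariski_open_proj_space torus_invariant_proj_space embedding_point)
qed

lemma list_object_simps [simp]:
  "ambient_dim (list_object xs) = length xs - 1" "emb (list_object xs) = emb_class (tuple_of xs)"
  by (simp_all add: list_object_def)

lemma spanning_list_exists: "\<exists>bs :: ('k::field, 'n::finite) dual list. dual.span (set bs) = UNIV"
proof -
  let ?b = "\<lambda>i :: 'n. functional_of (\<lambda>j. if j = i then 1 else 0) :: ('k, 'n) dual"
  have "f = (\<Sum>i\<in>UNIV. dual_scale (dual_coeffs f i) (?b i))" for f :: "('k, 'n) dual"
  proof -
    have *:
        "dual_apply (\<Sum>i\<in>A. dual_scale (dual_coeffs f i) (?b i)) x = (\<Sum>i\<in>A. dual_coeffs f i * x $ i)"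
      for A x
      by (induction A rule: infinite_finite_induct)
        (auto simp: dual_apply_zero dual_apply_add dual_apply_scale functional_of.rep_eq if_distrib[of "\<lambda>a. a * _"] cong: if_cong)
    show ?thesis
      by (rule dual_apply_inject[THEN iffD1]) (simp only: * dual_apply_coeffs[of f] fun_eq_iff, simp)
  qed
  then have "f \<in> dual.span (range ?b)" for f :: "('k, 'n) dual"
    by (metis (no_types, lifting) dual.span_base dual.span_scale dual.span_sum rangeI)
  moreover obtain bs where "set bs = range ?b" using finite_list[of "range ?b"] by auto
  ultimately show ?thesis by (intro exI[of _ bs]) auto
qed

text \<open>
  Pointwise proportional linear maps are proportional, because the factors at \<open>x\<close>, \<open>y\<close> and \<open>x + y\<close>
  have to agree unless the images of \<open>x\<close> and \<open>y\<close> are dependent, in which case \<open>x\<close> and \<open>y\<close> are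
  dependent by injectivity.
\<close>
lemma proportional_linear_maps:
  fixes A B :: "'k::field ^ 'n \<Rightarrow> nat \<Rightarrow> 'k"
  assumes A: "\<And>x y i. A (x + y) i = A x i + A y i" "\<And>c x i. A (c *s x) i = c * A x i"
    and B: "\<And>x y i. B (x + y) i = B x i + B y i" "\<And>c x i. B (c *s x) i = c * B x i"
    and inj: "\<And>x. B x = 0 \<Longrightarrow> x = 0"
    and rep: "\<And>x. x \<noteq> 0 \<Longrightarrow> proj_class (A x) = proj_class (B x)"
  shows "\<exists>c. c \<noteq> 0 \<and> (\<forall>x i. A x i = c * B x i)"
proof -
  have "\<exists>c. c \<noteq> 0 \<and> (\<forall>i. A x i = c * B x i)" if "x \<noteq> 0" for x
    using proj_class_eqD[OF rep[OF that]] by (metis (mono_tags))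
  then obtain c where c: "\<And>x. x \<noteq> 0 \<Longrightarrow> c x \<noteq> 0" "\<And>x i. x \<noteq> 0 \<Longrightarrow> A x i = c x * B x i" by metis
  have zero: "A 0 i = 0" "B 0 i = 0" for i using A(2)[of 0 0] B(2)[of 0 0] by simp_all
  have smult: "c (a *s x) = c x" if "a *s x \<noteq> 0" for a x
  proof -
    have "x \<noteq> 0" "a \<noteq> 0" using that by auto
    obtain i where i: "B x i \<noteq> 0" using inj[of x] \<open>x \<noteq> 0\<close> by (auto simp: fun_eq_iff)
    have "a * (c x * B x i) = c (a *s x) * (a * B x i)"
      using c(2)[OF that, of i] c(2)[OF \<open>x \<noteq> 0\<close>, of i] by (simp add: A B)
    then show ?thesis using i \<open>a \<noteq> 0\<close> by simp
  qed
  have const: "c x = c y" if xy: "x \<noteq> 0" "y \<noteq> 0" for x y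
  proof (cases "x + y = 0")
    case True
    then have "y = (-1) *s x" by (simp add: add_eq_0_iff vec_eq_iff)
    then show ?thesis using smult[of "-1" x] that by metis
  next
    case False
    have rel: "(c (x + y) - c x) * B x i = (c y - c (x + y)) * B y i" for i
      using c(2)[OF False, of i] c(2)[OF xy(1), of i] c(2)[OF xy(2), of i]
      by (simp add: A B algebra_simps)
    show ?thesis
    proof (cases "c (x + y) = c x")
      case True
      obtain i where "B y i \<noteq> 0" using inj[of y] xy(2) by (auto simp: fun_eq_iff)
      then show ?thesis using rel[of i] True by simp
    next
      case F: False
      define a where "a = (c y - c (x + y)) / (c (x + y) - c x)"
      have "B x i = B (a *s y) i" for i using rel[of i] F by (simp add: B a_def field_simps)
      then have "B (x + (-1) *s (a *s y)) = 0" by (simp only: B fun_eq_iff zero_fun_def) simp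
      then have "x + (-1) *s (a *s y) = 0" by (rule inj)
      then have "x = a *s y" by (simp add: vec_eq_iff)
      then show ?thesis using smult[of a y] that by simp
    qed
  qed
  have nz: "axis undefined 1 \<noteq> (0 :: 'k ^ 'n)" by (simp add: axis_eq_0_iff)
  have "A x i = c (axis undefined 1) * B x i" for x i
    using c(2)[of x i] const[OF _ nz, of x] by (cases "x = 0") (simp_all add: zero)
  then show ?thesis using c(1)[OF nz] by blast
qed

text \<open>
  Compatibility of a morphism is required for each point separately, up to a scalar; the scalar
  turns out to be independent of the point.
\<close>
lemma morphism_scalar:
  fixes X Y :: "('k::field, 'n::finite) embedding"
  assumes f: "emb X = emb_class f"
    and g: "emb Y = emb_class g" "g \<in> tuples (ambient_dim Y)"
        "dual.span (g ` {..ambient_dim Y}) = UNIV"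
    and \<sigma>: "is_morphism \<sigma> X Y"
  obtains c where "c \<noteq> 0" "\<And>j. j \<le> ambient_dim Y \<Longrightarrow> f (\<sigma> j) = dual_scale c (g j)"
proof -
  let ?m = "ambient_dim Y"
  let ?A = "\<lambda>x j. if j \<le> ?m then dual_apply (f (\<sigma> j)) x else 0"
  let ?B = "\<lambda>x j. dual_apply (g j) x"
  have "\<exists>c. c \<noteq> 0 \<and> (\<forall>x i. ?A x i = c * ?B x i)"
  proof (rule proportional_linear_maps)
    show "x = 0" if "?B x = 0" for x
      using spanning_nonvanishing[OF g(3), of x] that by (auto simp: fun_eq_iff)
    show "proj_class (?A x) = proj_class (?B x)" if "x \<noteq> 0" for x
    proof -
      have "scalar_class (*s) x \<in> vec_proj_space" using that unfolding projectivization_def by blast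
      then have "coord_map ?m \<sigma> (emb_map (emb X) (scalar_class (*s) x)) = emb_map (emb Y) (scalar_class (*s) x)"
        using \<sigma> unfolding is_morphism_def by blast
      then show ?thesis unfolding f g(1) emb_map_class coord_map_class .
    qed
  qed (auto simp: dual_apply_vec)
  then obtain c where c: "c \<noteq> 0" "\<And>x i. ?A x i = c * ?B x i" by blast
  have "f (\<sigma> j) = dual_scale c (g j)" if "j \<le> ?m" for j
  proof (rule dual_apply_inject[THEN iffD1], rule ext)
    fix x show "dual_apply (f (\<sigma> j)) x = dual_apply (dual_scale c (g j)) x"
      using c(2)[where x = x and i = j] that by (simp add: dual_apply_scale)
  qed
  then show ?thesis using that c(1) by blast
qed

section \<open>The canonical map\<close>
abbreviation seminorm_topology ::
    "('k::linordered_field \<Rightarrow> real) \<Rightarrow> (('k, 'n::finite) dual \<Rightarrow> real) topology" where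
  "seminorm_topology v \<equiv>
     subtopology (powertop_real UNIV) {N. signed_seminorm v dual_scale N \<and> N \<noteq> 0}"

lemma canonical_map_class:
  fixes X :: "('k::linordered_field, 'n::finite) embedding"
  assumes "compatible_nonarch_abs v" "signed_seminorm v dual_scale N" "X \<in> objects"
      "emb X = emb_class f"
  shows "canonical_map (proj_class N) X = proj_class (\<lambda>i. N (f i))"
  using evaluation_class[OF assms(1,2)] assms(3,4) by (simp add: canonical_map_def)

lemma seminorm_point:
  fixes N :: "('k::linordered_field, 'n::finite) dual \<Rightarrow> real"
  assumes v: "compatible_nonarch_abs v" and N: "signed_seminorm v dual_scale N" "N \<noteq> 0"
    and f: "f \<in> tuples m" "dual.span (f ` {..m}) = UNIV"
  shows "(\<lambda>i. N (f i)) \<in> tuples m - {0}"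
proof -
  interpret signed_seminormed dual_scale v N by (rule signed_seminormed_dual[OF v N(1)])
  obtain b where "b \<in> f ` {..m}" "N b \<noteq> 0" using spanning_seminorm_nonzero[OF v N f(2)] by blast
  then have "(\<lambda>i. N (f i)) \<noteq> 0" by (auto simp: fun_eq_iff)
  then show ?thesis using f(1) by (simp add: tuples_def)
qed

lemma Trop_limit_iff:
  "z \<in> topspace (Trop_limit v w h) \<longleftrightarrow> z \<in> extensional objects \<and>
     (\<forall>X\<in>objects. z X \<in> Trop_r v w h (ambient_dim X) (emb X)) \<and>
     (\<forall>X\<in>objects. \<forall>Y\<in>objects. \<forall>\<sigma>. is_morphism \<sigma> X Y \<longrightarrow> coord_map (ambient_dim Y) \<sigma> (z X) = z Y)"
proof -
  have "Trop_r v w h m \<iota> \<subseteq> topspace (RP_topology m)" for m \<iota>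
    unfolding Trop_r_def by (simp add: closure_of_subset_topspace)
  then have "topspace (RP_topology m) \<inter> Trop_r v w h m \<iota> = Trop_r v w h m \<iota>" for m \<iota> by blast
  then show ?thesis unfolding Trop_limit_def by (auto simp: PiE_iff)
qed

lemma canonical_map_in_limit:
  fixes N :: "('k::real_closed_field, 'n::finite) dual \<Rightarrow> real"
  assumes data: "tropical_data v w h" and N: "signed_seminorm v dual_scale N" "N \<noteq> 0"
  shows "canonical_map (proj_class N) \<in> topspace (Trop_limit v w h)"
  unfolding Trop_limit_iff
proof (intro conjI ballI allI impI)
  have v: "compatible_nonarch_abs v" using data unfolding tropical_data_def by blast
  show "canonical_map (proj_class N) \<in> extensional objects" by (simp add: canonical_map_def)
  fix X :: "('k, 'n) embedding" assume X: "X \<in> objects"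
  obtain f where f: "emb X = emb_class f" "f \<in> tuples (ambient_dim X)"
      "dual.span (f ` {..ambient_dim X}) = UNIV"
    using X by (rule objectE)
  note eval = canonical_map_class[OF v N(1) X f(1)]
  show "canonical_map (proj_class N) X \<in> Trop_r v w h (ambient_dim X) (emb X)"
    unfolding eval f(1) using seminorm_point[OF v N f(2,3)]
    by (intro seminorm_in_Trop_r[OF data f(2) N(1)]) blast
  fix Y :: "('k, 'n) embedding" and \<sigma> assume Y: "Y \<in> objects" and \<sigma>: "is_morphism \<sigma> X Y"
  obtain g where g: "emb Y = emb_class g" "g \<in> tuples (ambient_dim Y)"
      "dual.span (g ` {..ambient_dim Y}) = UNIV"
    using Y by (rule objectE)
  obtain c where c: "c \<noteq> 0" "\<And>j. j \<le> ambient_dim Y \<Longrightarrow> f (\<sigma> j) = dual_scale c (g j)"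
    using morphism_scalar[OF f(1) g \<sigma>] by blast
  have "N (dual_scale c a) = signed_abs v c * N a" for a
    using N(1) unfolding signed_seminorm_def signed_abs_def by blast
  then have "(\<lambda>j. if j \<le> ambient_dim Y then N (f (\<sigma> j)) else 0) = (\<lambda>j. signed_abs v c * N (g j))"
    using c(2) seminorm_point[OF v N g(2,3)] by (auto simp: tuples_def)
  then show "coord_map (ambient_dim Y) \<sigma> (canonical_map (proj_class N) X) = canonical_map (proj_class N) Y"
    unfolding eval canonical_map_class[OF v N(1) Y g(1)] coord_map_class
    using c(1) by (simp add: proj_class_scale signed_abs_eq_zero_iff[OF v])
qed

lemma continuous_canonical_map:
  fixes v :: "'k::real_closed_field \<Rightarrow> real" and h :: "'k \<Rightarrow> 'l::real_closed_field"
  assumes data: "tropical_data v w h"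
  shows "continuous_map (signed_GI_space v :: (('k, 'n::finite) dual \<Rightarrow> real) set topology) (Trop_limit v w h) canonical_map"
  unfolding signed_GI_space_def
proof (rule continuous_compose_quotient_map[OF quotient_map_quotient_topology])
  have v: "compatible_nonarch_abs v" using data unfolding tropical_data_def by blast
  let ?S = "seminorm_topology v :: (('k, 'n) dual \<Rightarrow> real) topology"
  have lim: "(canonical_map \<circ> proj_class) N \<in> topspace (Trop_limit v w h)" if "N \<in> topspace ?S"
    for N :: "('k, 'n) dual \<Rightarrow> real"
    using canonical_map_in_limit[OF data, of N] that by simp
  have comp:
      "continuous_map ?S (RP_topology (ambient_dim X)) (\<lambda>N. (canonical_map \<circ> proj_class) N X)"
    if X: "X \<in> objects" for X :: "('k, 'n) embedding"
  proof -
    obtain f where f: "emb X = emb_class f" "f \<in> tuples (ambient_dim X)"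
        "dual.span (f ` {..ambient_dim X}) = UNIV"
      using X by (rule objectE)
    have "continuous_map ?S (powertop_real UNIV) (\<lambda>N i. N (f i))"
      unfolding continuous_map_componentwise_UNIV
      by (intro allI continuous_map_from_subtopology continuous_map_product_projection) simp
    then have "continuous_map ?S (RP_cone (ambient_dim X)) (\<lambda>N i. N (f i))"
      unfolding RP_cone_eq continuous_map_in_subtopology using seminorm_point[OF v _ _ f(2,3)]
      by fastforce
    then have "continuous_map ?S (RP_topology (ambient_dim X)) (proj_class \<circ> (\<lambda>N i. N (f i)))"
      using continuous_proj_class continuous_map_compose by blast
    then show ?thesis
      by (rule continuous_map_eq) (auto simp: canonical_map_class[OF v _ X f(1)])
  qed
  show "continuous_map ?S (Trop_limit v w h) (canonical_map \<circ> proj_class)"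
    unfolding Trop_limit_def continuous_map_in_subtopology continuous_map_componentwise
    using lim comp unfolding Trop_limit_iff by (auto simp: image_subset_iff)
qed

section \<open>Reconstructing a seminorm from a point of the limit\<close>
lemma limit_point:
  fixes v :: "'k::real_closed_field \<Rightarrow> real" and X :: "('k, 'n::finite) embedding"
  assumes z: "z \<in> topspace (Trop_limit v w h)" and X: "X \<in> objects"
  shows "z X \<noteq> {}" and "x \<in> z X \<Longrightarrow> z X = proj_class x" and
      "x \<in> z X \<Longrightarrow> x \<in> tuples (ambient_dim X) - {0}"
proof -
  have "z X \<in> proj_space (ambient_dim X)"
    using z X closure_of_subset_topspace[of "RP_topology (ambient_dim X)"]
    unfolding Trop_limit_iff Trop_r_def topspace_RP by (metis (no_types, lifting) subsetD)
  then obtain y where y: "y \<in> tuples (ambient_dim X)" "y \<noteq> 0" "z X = proj_class y"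
    by (rule proj_spaceE)
  then show "z X \<noteq> {}" using proj_class_self by blast
  show eq: "z X = proj_class x" if "x \<in> z X" using that y(3) proj_class_eqI by blast
  show "x \<in> tuples (ambient_dim X) - {0}" if "x \<in> z X"
    using \<open>z X \<in> proj_space (ambient_dim X)\<close> unfolding eq[OF that] proj_space_class by blast
qed

lemma limit_closed_condition:
  fixes v :: "'k::real_closed_field \<Rightarrow> real" and X :: "('k, 'n::finite) embedding"
  assumes data: "tropical_data v w h" and z: "z \<in> topspace (Trop_limit v w h)"
    and X: "X \<in> objects" "emb X = emb_class f" "f \<in> tuples (ambient_dim X)"
    and C: "closed C" "\<And>c x. c \<noteq> 0 \<Longrightarrow> x \<in> C \<Longrightarrow> (\<lambda>i. c * x i) \<in> C"
    and holds: "\<And>\<phi>. signed_seminorm v dual_scale \<phi> \<Longrightarrow> (\<lambda>i. \<phi> (f i)) \<in> C"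
    and x: "x \<in> z X"
  shows "x \<in> C"
  using Trop_r_closed_condition[OF data X(3) C holds _ x] z X(1,2) unfolding Trop_limit_iff by metis

lemma limit_coordinates_eq:
  fixes v :: "'k::real_closed_field \<Rightarrow> real" and X :: "('k, 'n::finite) embedding"
  assumes data: "tropical_data v w h" and z: "z \<in> topspace (Trop_limit v w h)"
    and X: "X \<in> objects" "emb X = emb_class f" "f \<in> tuples (ambient_dim X)"
    and x: "x \<in> z X" and eq: "f i = f j"
  shows "x i = x j"
proof -
  have "x \<in> {x. x i = x j}"
  proof (rule limit_closed_condition[OF data z X _ _ _ x])
    show "closed {x :: nat \<Rightarrow> real. x i = x j}"
      by (intro closed_Collect_eq continuous_on_product_coordinates)
  qed (use eq in auto)
  then show ?thesis by simp
qed

text \<open>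
  Both representatives are cut out of one representative over the join of the two embeddings, so
  they are scaled alike.
\<close>
lemma limit_common_coordinates:
  fixes v :: "'k::real_closed_field \<Rightarrow> real" and X Y :: "('k, 'n::finite) embedding"
  assumes data: "tropical_data v w h" and z: "z \<in> topspace (Trop_limit v w h)"
    and X: "X \<in> objects" "emb X = emb_class f" "f \<in> tuples (ambient_dim X)"
        "dual.span (f ` {..ambient_dim X}) = UNIV"
    and Y: "Y \<in> objects" "emb Y = emb_class g" "g \<in> tuples (ambient_dim Y)"
  obtains x y where "x \<in> z X" "y \<in> z Y"
    "\<And>i j. i \<le> ambient_dim X \<Longrightarrow> j \<le> ambient_dim Y \<Longrightarrow> f i = g j \<Longrightarrow> x i = y j"
proof -
  let ?m = "ambient_dim X" and ?m' = "ambient_dim Y"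
  let ?k = "join_tuple ?m f g" and ?\<tau> = "\<lambda>j. j + Suc ?m"
  obtain Z :: "('k, 'n) embedding" where Z: "Z \<in> objects" "emb Z = emb_class ?k"
      "?k \<in> tuples (ambient_dim Z)"
    "is_morphism id Z X" "is_morphism ?\<tau> Z Y"
    using join_object[OF X Y] by blast
  obtain u where u: "u \<in> z Z" using limit_point(1)[OF z Z(1)] by blast
  have "z X = coord_map ?m id (z Z)" "z Y = coord_map ?m' ?\<tau> (z Z)"
    using z Z X(1) Y(1) unfolding Trop_limit_iff by metis+
  then have mem: "(\<lambda>j. if j \<le> ?m then u (id j) else 0) \<in> z X"
      "(\<lambda>j. if j \<le> ?m' then u (?\<tau> j) else 0) \<in> z Y"
    unfolding coord_map_def using u by blast+
  have "u i = u (?\<tau> j)" if "i \<le> ?m" "j \<le> ?m'" "f i = g j" for i j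
    using that by (intro limit_coordinates_eq[OF data z Z(1-3) u]) (simp add: join_tuple_def)
  then show ?thesis by (intro that[OF mem]) simp
qed

text \<open>Homogeneous of degree zero, hence independent of the chosen representative.\<close>
definition coordinate_ratio :: "nat \<Rightarrow> nat \<Rightarrow> (nat \<Rightarrow> real) set \<Rightarrow> real" where
  "coordinate_ratio i j p = (let x = SOME x. x \<in> p in x i / x j)"

lemma coordinate_ratio_class: "coordinate_ratio i j (proj_class x) = x i / x j"
proof -
  have "(SOME y. y \<in> proj_class x) \<in> proj_class x" by (rule someI[of _ x]) simp
  then obtain c where "c \<noteq> 0" "(SOME y. y \<in> proj_class x) = (\<lambda>i. c * x i)" unfolding mem_proj_class
    by blast
  then show ?thesis by (simp add: coordinate_ratio_def)
qed

lemma openin_nonvanishing: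
  "openin (RP_topology m) {p \<in> proj_space m. \<forall>x\<in>p. x j \<noteq> 0}" (is "openin _ ?U")
proof -
  have "?U = proj_class ` ((tuples m - {0}) \<inter> {x. x j \<noteq> 0})"
    unfolding projectivization_def by (auto simp: mem_proj_class intro!: imageI)
  moreover have "openin (RP_topology m) (proj_class ` ((tuples m - {0}) \<inter> {x. x j \<noteq> 0}))"
    by (intro openin_RP_topologyI open_Collect_neq continuous_intros continuous_on_product_coordinates) auto
  ultimately show ?thesis by simp
qed

lemma continuous_coordinate_ratio:
  "continuous_map (subtopology (RP_topology m) {p. \<forall>x\<in>p. x j \<noteq> 0}) euclideanreal (coordinate_ratio i j)"
  unfolding continuous_map_def
proof (intro conjI allI impI)
  fix V :: "real set" assume "openin euclidean V"
  then have V: "open V" by simp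
  let ?U = "{x :: nat \<Rightarrow> real. x j \<noteq> 0}"
  have "open ?U" by (intro open_Collect_neq continuous_intros continuous_on_product_coordinates)
  moreover have "continuous_on ?U (\<lambda>x. x i / x j)"
    by (intro continuous_on_divide continuous_on_subset[OF continuous_on_product_coordinates]) auto
  ultimately have op: "open ((\<lambda>x. x i / x j) -` V \<inter> ?U)"
    using V by (simp add: continuous_on_open_vimage)
  have "openin (RP_topology m) (proj_class ` ((tuples m - {0}) \<inter> ((\<lambda>x. x i / x j) -` V \<inter> ?U)))"
    using op by (rule openin_RP_topologyI) auto
  moreover have "{p \<in> topspace (subtopology (RP_topology m) {p. \<forall>x\<in>p. x j \<noteq> 0}). coordinate_ratio i j p \<in> V} =
      proj_class ` ((tuples m - {0}) \<inter> ((\<lambda>x. x i / x j) -` V \<inter> ?U)) \<inter> {p. \<forall>x\<in>p. x j \<noteq> 0}"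
    unfolding topspace_subtopology topspace_RP projectivization_def
    by (auto simp: coordinate_ratio_class mem_proj_class intro!: imageI)
  ultimately show "openin (subtopology (RP_topology m) {p. \<forall>x\<in>p. x j \<noteq> 0})
      {p \<in> topspace (subtopology (RP_topology m) {p. \<forall>x\<in>p. x j \<noteq> 0}). coordinate_ratio i j p \<in> V}"
    unfolding openin_subtopology by blast
qed auto

text \<open>
  In the tuple \<open>g # bs\<close> the functional \<open>g\<close> has index 0 and \<open>bs ! k\<close> has index \<open>Suc k\<close>.
  The quotient is the value at \<open>g\<close> of the representative that is 1 at \<open>bs ! k\<close>.
\<close>
definition normalized_seminorm ::
    "('k::field, 'n::finite) dual list \<Rightarrow> nat \<Rightarrow> (('k, 'n) embedding \<Rightarrow> (nat \<Rightarrow> real) set) \<Rightarrow> ('k, 'n) dual \<Rightarrow> real" where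
  "normalized_seminorm bs k z g = coordinate_ratio 0 (Suc k) (z (list_object (g # bs)))"

lemma spanning_append:
  "dual.span (set bs) = UNIV \<Longrightarrow> dual.span (set (xs @ bs)) = (UNIV :: ('k::field, 'n::finite) dual set)"
  using dual.span_mono[of "set bs" "set (xs @ bs)"] by auto

text \<open>
  Any embedding that contains \<open>bs ! k\<close> computes the normalized values of all its functionals
  simultaneously. This is what allows relations between several functionals to be tested.
\<close>
lemma limit_coordinates_normalized:
  fixes v :: "'k::real_closed_field \<Rightarrow> real" and X :: "('k, 'n::finite) embedding"
  assumes data: "tropical_data v w h" and z: "z \<in> topspace (Trop_limit v w h)"
    and bs: "dual.span (set bs) = UNIV" "k < length bs" "\<forall>x\<in>z (list_object bs). x k \<noteq> 0"
    and X: "X \<in> objects" "emb X = emb_class f" "f \<in> tuples (ambient_dim X)"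
        "dual.span (f ` {..ambient_dim X}) = UNIV"
    and l: "l \<le> ambient_dim X" "f l = bs ! k" and u: "u \<in> z X"
  shows "u l \<noteq> 0" and "j \<le> ambient_dim X \<Longrightarrow> normalized_seminorm bs k z (f j) = u j / u l"
proof -
  note B = list_object[OF bs(1)]
  obtain x y where xy: "x \<in> z X" "y \<in> z (list_object bs)"
    "\<And>i j. i \<le> ambient_dim X \<Longrightarrow> j \<le> length bs - 1 \<Longrightarrow> f i = tuple_of bs j \<Longrightarrow> x i = y j"
    using limit_common_coordinates[OF data z X B(2) list_object_simps(2)] B(3) by simp blast
  have "x l = y k" using xy(3)[of l k] l bs(2) by (simp add: tuple_of_def)
  then have "x l \<noteq> 0" using bs(3) xy(2) by simp
  moreover obtain c where "x = (\<lambda>i. c * u i)"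
    using xy(1) unfolding limit_point(2)[OF z X(1) u] mem_proj_class by blast
  ultimately show "u l \<noteq> 0" by auto
  assume j: "j \<le> ambient_dim X"
  have span: "dual.span (set (f j # bs)) = UNIV" using spanning_append[OF bs(1), of "[f j]"] by simp
  note G = list_object[OF span]
  obtain x y where xy: "x \<in> z X" "y \<in> z (list_object (f j # bs))"
    "\<And>i i'. i \<le> ambient_dim X \<Longrightarrow> i' \<le> length bs \<Longrightarrow> f i = tuple_of (f j # bs) i' \<Longrightarrow> x i = y i'"
    using limit_common_coordinates[OF data z X G(2) list_object_simps(2)] G(3) by simp blast
  have "x j = y 0" "x l = y (Suc k)"
    using xy(3)[of j 0] xy(3)[of l "Suc k"] l j bs(2) by (simp_all add: tuple_of_def)
  moreover obtain c where "c \<noteq> 0" "x = (\<lambda>i. c * u i)"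
    using xy(1) unfolding limit_point(2)[OF z X(1) u] mem_proj_class by blast
  ultimately show "normalized_seminorm bs k z (f j) = u j / u l"
    unfolding normalized_seminorm_def limit_point(2)[OF z G(2) xy(2)] coordinate_ratio_class
    by (metis mult_divide_mult_cancel_left)
qed

lemma limit_normalized_representative:
  fixes v :: "'k::real_closed_field \<Rightarrow> real" and X :: "('k, 'n::finite) embedding"
  assumes data: "tropical_data v w h" and z: "z \<in> topspace (Trop_limit v w h)"
    and bs: "dual.span (set bs) = UNIV" "k < length bs" "\<forall>x\<in>z (list_object bs). x k \<noteq> 0"
    and X: "X \<in> objects" "emb X = emb_class f" "f \<in> tuples (ambient_dim X)"
        "dual.span (f ` {..ambient_dim X}) = UNIV"
    and l: "l \<le> ambient_dim X" "f l = bs ! k"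
  obtains u where "u \<in> z X" "\<And>j. j \<le> ambient_dim X \<Longrightarrow> normalized_seminorm bs k z (f j) = u j"
proof -
  obtain x where x: "x \<in> z X" using limit_point(1)[OF z X(1)] by blast
  note facts = limit_coordinates_normalized[OF data z bs X l x]
  have "(\<lambda>i. inverse (x l) * x i) \<in> z X"
    unfolding limit_point(2)[OF z X(1) x] mem_proj_class using facts(1)
    by (intro exI[of _ "inverse (x l)"]) simp
  then show ?thesis using facts(2)
    by (intro that[of "\<lambda>i. inverse (x l) * x i"]) (auto simp: divide_inverse mult.commute)
qed

text \<open>
  A closed scaling-invariant relation that every signed seminorm satisfies on the functionals \<open>xs\<close>
  is inherited by the normalized values; appending \<open>bs\<close> makes \<open>xs\<close> an embedding.
\<close>
lemma normalized_seminorm_list: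
  fixes v :: "'k::real_closed_field \<Rightarrow> real" and bs :: "('k, 'n::finite) dual list"
  assumes data: "tropical_data v w h" and z: "z \<in> topspace (Trop_limit v w h)"
    and bs: "dual.span (set bs) = UNIV" "k < length bs" "\<forall>x\<in>z (list_object bs). x k \<noteq> 0"
    and C: "closed C" "\<And>c x. c \<noteq> 0 \<Longrightarrow> x \<in> C \<Longrightarrow> (\<lambda>i. c * x i) \<in> C"
    and holds: "\<And>\<phi>. signed_seminorm v dual_scale \<phi> \<Longrightarrow> (\<lambda>i. \<phi> (tuple_of (xs @ bs) i)) \<in> C"
  obtains u where "u \<in> C"
      "\<And>j. j < length xs + length bs \<Longrightarrow> normalized_seminorm bs k z ((xs @ bs) ! j) = u j"
proof -
  note L = list_object[OF spanning_append[OF bs(1), of xs]]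
  let ?X = "list_object (xs @ bs)"
  have X: "?X \<in> objects" "emb ?X = emb_class (tuple_of (xs @ bs))"
      "tuple_of (xs @ bs) \<in> tuples (ambient_dim ?X)"
    "dual.span (tuple_of (xs @ bs) ` {..ambient_dim ?X}) = UNIV"
    using L by simp_all
  obtain u where u: "u \<in> z ?X"
      "\<And>j. j \<le> ambient_dim ?X \<Longrightarrow> normalized_seminorm bs k z (tuple_of (xs @ bs) j) = u j"
  proof (rule limit_normalized_representative[OF data z bs X])
    show "length xs + k \<le> ambient_dim ?X" "tuple_of (xs @ bs) (length xs + k) = bs ! k"
      using bs(2) by (simp_all add: tuple_of_def nth_append)
  qed (use that in auto)
  show ?thesis
  proof
    show "u \<in> C" by (rule limit_closed_condition[OF data z X(1-3) C holds u(1)])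
    show "normalized_seminorm bs k z ((xs @ bs) ! j) = u j" if "j < length xs + length bs" for j
      using u(2)[of j] that by (simp add: tuple_of_def)
  qed
qed

lemma normalized_seminorm_is_seminorm:
  fixes v :: "'k::real_closed_field \<Rightarrow> real" and bs :: "('k, 'n::finite) dual list"
  assumes data: "tropical_data v w h" and z: "z \<in> topspace (Trop_limit v w h)"
    and bs: "dual.span (set bs) = UNIV" "k < length bs" "\<forall>x\<in>z (list_object bs). x k \<noteq> 0"
  shows "signed_seminorm v dual_scale (normalized_seminorm bs k z)" "normalized_seminorm bs k z \<noteq> 0"
proof -
  let ?N = "normalized_seminorm bs k z"
  note rel = normalized_seminorm_list[OF data z bs]
  have scale: "?N (dual_scale c f) = real_sgn c * v c * ?N f" for c f
  proof -
    have holds: "(\<lambda>i. \<phi> (tuple_of ([f, dual_scale c f] @ bs) i)) \<in> {x. x 1 = signed_abs v c * x 0}"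
      if "signed_seminorm v dual_scale \<phi>" for \<phi>
      using that unfolding signed_seminorm_def by (simp add: tuple_of_def signed_abs_def)
    obtain u where u: "u \<in> {x. x 1 = signed_abs v c * x 0}"
      "\<And>j. j < length [f, dual_scale c f] + length bs \<Longrightarrow> ?N (([f, dual_scale c f] @ bs) ! j) = u j"
    proof (rule rel[OF _ _ holds])
      show "closed {x :: nat \<Rightarrow> real. x 1 = signed_abs v c * x 0}"
        by (intro closed_Collect_eq continuous_intros continuous_on_product_coordinates)
    qed (auto simp: mult.left_commute)
    show ?thesis using u(1) u(2)[of 0] u(2)[of 1] by (simp add: signed_abs_def)
  qed
  have add: "min (?N f) (?N g) \<le> ?N (f + g) \<and> ?N (f + g) \<le> max (?N f) (?N g)" for f g
  proof -
    \<comment> \<open>A form of \<open>min (x 0) (x 1) \<le> x 2 \<le> max (x 0) (x 1)\<close> in which invariance under negative scalars is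
      visible.\<close>
    let ?C = "{x :: nat \<Rightarrow> real. (x 2 - x 0) * (x 2 - x 1) \<le> 0}"
    have holds: "(\<lambda>i. \<phi> (tuple_of ([f, g, f + g] @ bs) i)) \<in> ?C" if "signed_seminorm v dual_scale \<phi>"
      for \<phi>
    proof -
      have "min (\<phi> f) (\<phi> g) \<le> \<phi> (f + g)" "\<phi> (f + g) \<le> max (\<phi> f) (\<phi> g)"
        using that unfolding signed_seminorm_def by blast+
      then have "(\<phi> (f + g) - \<phi> f) * (\<phi> (f + g) - \<phi> g) \<le> 0"
        by (auto simp: mult_le_0_iff min_def max_def split: if_splits)
      then show ?thesis by (simp add: tuple_of_def)
    qed
    have scaled: "(\<lambda>i. c * x i) \<in> ?C" if "x \<in> ?C" for c x
    proof -
      have "(c * x 2 - c * x 0) * (c * x 2 - c * x 1) = c\<^sup>2 * ((x 2 - x 0) * (x 2 - x 1))"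
        by (simp add: power2_eq_square algebra_simps)
      also have "\<dots> \<le> 0" using that by (simp add: mult_nonneg_nonpos)
      finally show ?thesis by simp
    qed
    obtain u where u: "u \<in> ?C"
      "\<And>j. j < length [f, g, f + g] + length bs \<Longrightarrow> ?N (([f, g, f + g] @ bs) ! j) = u j"
    proof (rule rel[OF _ _ holds])
      show "closed ?C"
        by (intro closed_Collect_le continuous_intros continuous_on_product_coordinates)
      show "(\<lambda>i. c * x i) \<in> ?C" if "x \<in> ?C" for c x using that by (rule scaled)
    next
      fix u assume "u \<in> ?C"
          "\<And>j. j < length [f, g, f + g] + length bs \<Longrightarrow> ?N (([f, g, f + g] @ bs) ! j) = u j"
      then show thesis by (rule that)
    qed
    have "(?N (f + g) - ?N f) * (?N (f + g) - ?N g) \<le> 0"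
      using u(1) u(2)[of 0] u(2)[of 1] u(2)[of 2] by simp
    then show ?thesis by (auto simp: mult_le_0_iff)
  qed
  show "signed_seminorm v dual_scale ?N" unfolding signed_seminorm_def using scale add by blast
  obtain x where x: "x \<in> z (list_object bs)" using limit_point(1)[OF z list_object(2)[OF bs(1)]]
    by blast
  have "?N (tuple_of bs k) = x k / x k"
    using limit_coordinates_normalized(2)[OF data z bs list_object(2)[OF bs(1)], of "tuple_of bs" k x k]
      list_object(3,4)[OF bs(1)] bs(2) x by (simp add: tuple_of_def)
  then have "?N (tuple_of bs k) \<noteq> 0" using bs(3) x by auto
  then show "?N \<noteq> 0" by auto
qed

text \<open>
  An arbitrary embedding need not contain \<open>bs ! k\<close>, so it is compared with its join with the
  embedding given by \<open>bs\<close>.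
\<close>
lemma canonical_map_normalized:
  fixes v :: "'k::real_closed_field \<Rightarrow> real" and bs :: "('k, 'n::finite) dual list"
  assumes data: "tropical_data v w h" and z: "z \<in> topspace (Trop_limit v w h)"
    and bs: "dual.span (set bs) = UNIV" "k < length bs" "\<forall>x\<in>z (list_object bs). x k \<noteq> 0"
  shows "canonical_map (proj_class (normalized_seminorm bs k z)) = z"
proof (rule extensionalityI[of _ objects])
  let ?N = "normalized_seminorm bs k z"
  have v: "compatible_nonarch_abs v" using data unfolding tropical_data_def by blast
  note N = normalized_seminorm_is_seminorm[OF data z bs]
  interpret signed_seminormed dual_scale v ?N by (rule signed_seminormed_dual[OF v N(1)])
  show "canonical_map (proj_class ?N) \<in> extensional objects" by (simp add: canonical_map_def)
  show "z \<in> extensional objects" using z unfolding Trop_limit_iff by blast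
  fix X :: "('k, 'n) embedding" assume X: "X \<in> objects"
  obtain f where f: "emb X = emb_class f" "f \<in> tuples (ambient_dim X)"
      "dual.span (f ` {..ambient_dim X}) = UNIV"
    using X by (rule objectE)
  let ?m = "ambient_dim X" and ?B = "list_object bs"
  let ?k = "join_tuple ?m f (tuple_of bs)"
  note B = list_object[OF bs(1)]
  have B': "emb ?B = emb_class (tuple_of bs)" "tuple_of bs \<in> tuples (ambient_dim ?B)" using B(3)
    by simp_all
  obtain Z :: "('k, 'n) embedding" where Z: "Z \<in> objects"
      "ambient_dim Z = Suc (?m + ambient_dim ?B)"
    "emb Z = emb_class ?k" "?k \<in> tuples (ambient_dim Z)" "is_morphism id Z X"
    using join_object[OF X f B(2) B'] by blast
  have "f ` {..?m} \<subseteq> ?k ` {..ambient_dim Z}" by (force simp: join_tuple_def Z(2))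
  then have span: "dual.span (?k ` {..ambient_dim Z}) = UNIV"
    using dual.span_mono[of "f ` {..?m}" "?k ` {..ambient_dim Z}"] f(3) by auto
  obtain u where u: "u \<in> z Z" "\<And>j. j \<le> ambient_dim Z \<Longrightarrow> ?N (?k j) = u j"
  proof (rule limit_normalized_representative[OF data z bs Z(1,3,4) span])
    show "Suc ?m + k \<le> ambient_dim Z" "?k (Suc ?m + k) = bs ! k"
      using bs(2) by (simp_all add: Z(2) join_tuple_def tuple_of_def)
  qed (use that in auto)
  have "z X = coord_map ?m id (z Z)" using z Z(1,5) X unfolding Trop_limit_iff by metis
  then have "(\<lambda>j. if j \<le> ?m then u (id j) else 0) \<in> z X" using u(1) by (auto simp: coord_map_def)
  moreover have "(\<lambda>j. if j \<le> ?m then u (id j) else 0) = (\<lambda>j. ?N (f j))"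
  proof
    fix j show "(if j \<le> ?m then u (id j) else 0) = ?N (f j)"
      using u(2)[of j] f(2) by (auto simp: Z(2) join_tuple_def tuples_def)
  qed
  ultimately have "z X = proj_class (\<lambda>j. ?N (f j))" using limit_point(2)[OF z X] by simp
  then show "canonical_map (proj_class ?N) X = z X" unfolding canonical_map_class[OF v N(1) X f(1)]
    by simp
qed

lemma normalized_canonical_map:
  fixes N :: "('k::linordered_field, 'n::finite) dual \<Rightarrow> real"
  assumes v: "compatible_nonarch_abs v" and N: "signed_seminorm v dual_scale N"
    and bs: "dual.span (set bs) = UNIV" "k < length bs" "N (bs ! k) \<noteq> 0"
  shows "proj_class (normalized_seminorm bs k (canonical_map (proj_class N))) = proj_class N"
proof -
  have "normalized_seminorm bs k (canonical_map (proj_class N)) g = inverse (N (bs ! k)) * N g"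
    for g
  proof -
    have "dual.span (set (g # bs)) = UNIV" using spanning_append[OF bs(1), of "[g]"] by simp
    note G = list_object[OF this]
    show ?thesis
      unfolding normalized_seminorm_def canonical_map_class[OF v N G(2) list_object_simps(2)] coordinate_ratio_class
      using bs(2) by (simp add: tuple_of_def divide_inverse mult.commute)
  qed
  then have
      "normalized_seminorm bs k (canonical_map (proj_class N)) = (\<lambda>g. inverse (N (bs ! k)) * N g)"
    by blast
  then show ?thesis using bs(3) by (simp add: proj_class_scale)
qed

section \<open>Continuity of the inverse\<close>
lemma continuous_normalized_seminorm:
  fixes v :: "'k::real_closed_field \<Rightarrow> real" and bs :: "('k, 'n::finite) dual list"
  assumes data: "tropical_data v w h" and bs: "dual.span (set bs) = UNIV" "k < length bs"
  shows "continuous_map (subtopology (Trop_limit v w h) {z. \<forall>x\<in>z (list_object bs). x k \<noteq> 0}) (signed_GI_space v)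
           (\<lambda>z. proj_class (normalized_seminorm bs k z))"
proof -
  let ?D = "{z. \<forall>x\<in>z (list_object bs). x k \<noteq> 0}"
  let ?T = "subtopology (Trop_limit v w h) ?D"
  have "continuous_map ?T euclideanreal (\<lambda>z. normalized_seminorm bs k z g)" for g
  proof -
    have "dual.span (set (g # bs)) = UNIV" using spanning_append[OF bs(1), of "[g]"] by simp
    note G = list_object[OF this]
    let ?X = "list_object (g # bs)"
    have "continuous_map (Trop_limit v w h) (RP_topology (ambient_dim ?X)) (\<lambda>z. z ?X)"
      unfolding Trop_limit_def
      by (intro continuous_map_from_subtopology continuous_map_into_fulltopology[OF continuous_map_product_projection[OF G(2)]])
    then have "continuous_map ?T (RP_topology (ambient_dim ?X)) (\<lambda>z. z ?X)"
      by (rule continuous_map_from_subtopology)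
    moreover have "z ?X \<in> {p. \<forall>x\<in>p. x (Suc k) \<noteq> 0}" if "z \<in> topspace ?T" for z
    proof -
      have z: "z \<in> topspace (Trop_limit v w h)" "\<forall>x\<in>z (list_object bs). x k \<noteq> 0" using that by auto
      show ?thesis
        using limit_coordinates_normalized(1)[OF data z(1) bs z(2) G(2), of "tuple_of (g # bs)" "Suc k"] G(3,4) bs(2)
        by (auto simp: tuple_of_def)
    qed
    ultimately have
        "continuous_map ?T (subtopology (RP_topology (ambient_dim ?X)) {p. \<forall>x\<in>p. x (Suc k) \<noteq> 0}) (\<lambda>z. z ?X)"
      by (intro continuous_map_into_subtopology) auto
    from continuous_map_compose[OF this continuous_coordinate_ratio[of _ _ 0]]
    show ?thesis by (simp add: o_def normalized_seminorm_def)
  qed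
  then have "continuous_map ?T (powertop_real UNIV) (normalized_seminorm bs k)"
    unfolding continuous_map_componentwise_UNIV by blast
  then have "continuous_map ?T (seminorm_topology v) (normalized_seminorm bs k)"
    using normalized_seminorm_is_seminorm[OF data _ bs]
    by (intro continuous_map_into_subtopology) auto
  then have "continuous_map ?T (signed_GI_space v) (proj_class \<circ> normalized_seminorm bs k)"
    unfolding signed_GI_space_def
    using quotient_imp_continuous_map[OF quotient_map_quotient_topology]
    by (rule continuous_map_compose)
  then show ?thesis by (simp add: o_def)
qed

text \<open>
  The open sets on which the coordinate at \<open>bs ! k\<close> does not vanish cover the limit, since \<open>bs\<close>
  spans; on each of them the class of the normalized seminorm is a continuous inverse, and the
  inverses are pasted.
\<close>
theorem theorem0p1:
  fixes v :: "'k::real_closed_field \<Rightarrow> real"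
    and w :: "'l::real_closed_field \<Rightarrow> real"
    and h :: "'k \<Rightarrow> 'l"
    and n :: nat
  assumes "compatible_nonarch_abs v"
    and "trivial_abs v \<Longrightarrow>
      compatible_nonarch_abs w \<and> \<not> trivial_abs w \<and> valued_extension v w h"
    and "CARD('n::finite) = n + 1"
  shows "homeomorphic_map (signed_GI_space v :: (('k, 'n) dual \<Rightarrow> real) set topology)
           (Trop_limit v w h) canonical_map"
proof -
  note v = assms(1)
  have data: "tropical_data v w h" using assms(1,2) by (auto simp: tropical_data_def)
  obtain bs :: "('k, 'n) dual list" where bs: "dual.span (set bs) = UNIV" using spanning_list_exists
    by blast
  note B = list_object[OF bs]
  let ?GI = "signed_GI_space v :: (('k, 'n) dual \<Rightarrow> real) set topology"
  let ?L = "Trop_limit v w h :: (('k, 'n) embedding \<Rightarrow> (nat \<Rightarrow> real) set) topology"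
  let ?D = "\<lambda>k. {z \<in> topspace ?L. \<forall>x\<in>z (list_object bs). x k \<noteq> 0}"
  have GI: "topspace ?GI = proj_class ` {N. signed_seminorm v dual_scale N \<and> N \<noteq> 0}"
    unfolding signed_GI_space_def by simp
  have cover: "\<exists>k<length bs. z \<in> ?D k" if z: "z \<in> topspace ?L" for z
  proof -
    obtain x where x: "x \<in> z (list_object bs)" using limit_point(1)[OF z B(2)] by blast
    have x0: "x \<in> tuples (length bs - 1) - {0}" using limit_point(3)[OF z B(2) x] by simp
    then obtain k where k: "x k \<noteq> 0" by (auto simp: fun_eq_iff)
    then have "k \<le> length bs - 1" using x0 by (intro leI) (auto simp: tuples_def)
    then have "k < length bs" using B(1) by (cases bs) auto
    moreover have "\<forall>y\<in>z (list_object bs). y k \<noteq> 0"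
      unfolding limit_point(2)[OF z B(2) x] by (auto simp: mem_proj_class k)
    ultimately show ?thesis using z by blast
  qed
  have left:
      "\<exists>k<length bs. canonical_map \<xi> \<in> ?D k \<and> proj_class (normalized_seminorm bs k (canonical_map \<xi>)) = \<xi>"
    if xi: "\<xi> \<in> topspace ?GI" for \<xi>
  proof -
    obtain N where N: "signed_seminorm v dual_scale N" "N \<noteq> 0" "\<xi> = proj_class N" using xi
      unfolding GI by blast
    have lim: "canonical_map \<xi> \<in> topspace ?L" unfolding N(3)
      by (rule canonical_map_in_limit[OF data N(1,2)])
    then obtain k where k: "k < length bs" "canonical_map \<xi> \<in> ?D k" using cover by blast
    have "canonical_map \<xi> (list_object bs) = proj_class (\<lambda>i. N (tuple_of bs i))"
      unfolding N(3) by (rule canonical_map_class[OF v N(1) B(2)]) simp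
    then have "N (bs ! k) \<noteq> 0" using k
      by (auto simp: tuple_of_def dest!: bspec[OF _ proj_class_self])
    then show ?thesis using k normalized_canonical_map[OF v N(1) bs k(1)] unfolding N(3) by blast
  qed
  have right: "proj_class (normalized_seminorm bs k z) \<in> topspace ?GI"
      "canonical_map (proj_class (normalized_seminorm bs k z)) = z"
    if "k < length bs" "z \<in> ?D k" for k z
    using normalized_seminorm_is_seminorm[OF data _ bs that(1)] canonical_map_normalized[OF data _ bs that(1)] that(2)
    unfolding GI by auto
  have inj: "\<xi> = \<xi>'" if xi: "\<xi> \<in> topspace ?GI" "\<xi>' \<in> topspace ?GI"
      "canonical_map \<xi> = canonical_map \<xi>'" for \<xi> \<xi>'
  proof -
    obtain N' where N': "signed_seminorm v dual_scale N'" "N' \<noteq> 0" "\<xi>' = proj_class N'" using xi(2)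
      unfolding GI by blast
    obtain k where k: "k < length bs" "canonical_map \<xi> \<in> ?D k"
        "proj_class (normalized_seminorm bs k (canonical_map \<xi>)) = \<xi>"
      using left[OF xi(1)] by blast
    have "canonical_map \<xi>' (list_object bs) = proj_class (\<lambda>i. N' (tuple_of bs i))"
      unfolding N'(3) by (rule canonical_map_class[OF v N'(1) B(2)]) simp
    then have "N' (bs ! k) \<noteq> 0" using k(1,2) unfolding xi(3)
      by (auto simp: tuple_of_def dest!: bspec[OF _ proj_class_self])
    from normalized_canonical_map[OF v N'(1) bs k(1) this] show ?thesis using k(3) xi(3) N'(3)
      by simp
  qed
  define g where "g = inv_into (topspace ?GI) canonical_map"
  have g: "g z = proj_class (normalized_seminorm bs k z)" if "k < length bs" "z \<in> ?D k" for k z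
    unfolding g_def using right[OF that] inj
    by (intro inv_into_f_eq) (auto intro: inj_onI)
  have "continuous_map ?L ?GI g"
  proof (rule pasting_lemma[where I = "{..<length bs}" and T = ?D and f = "\<lambda>k z. proj_class (normalized_seminorm bs k z)"])
    fix k assume "k \<in> {..<length bs}"
    then have k: "k < length bs" by simp
    have "continuous_map ?L (RP_topology (ambient_dim (list_object bs))) (\<lambda>z. z (list_object bs))"
      unfolding Trop_limit_def
      by (intro continuous_map_from_subtopology continuous_map_into_fulltopology[OF continuous_map_product_projection[OF B(2)]])
    from openin_continuous_map_preimage[OF this openin_nonvanishing[of _ k]]
    have "openin ?L {z \<in> topspace ?L. z (list_object bs) \<in> {p \<in> proj_space (ambient_dim (list_object bs)). \<forall>x\<in>p. x k \<noteq> 0}}" .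
    moreover have "z (list_object bs) \<in> proj_space (ambient_dim (list_object bs))" if z:
        "z \<in> topspace ?L" for z
    proof -
      obtain x where x: "x \<in> z (list_object bs)" using limit_point(1)[OF z B(2)] by blast
      show ?thesis
        using limit_point(3)[OF z B(2) x] unfolding limit_point(2)[OF z B(2) x] proj_space_class
        by blast
    qed
    then have
        "{z \<in> topspace ?L. z (list_object bs) \<in> {p \<in> proj_space (ambient_dim (list_object bs)). \<forall>x\<in>p. x k \<noteq> 0}} = ?D k"
      by blast
    ultimately show "openin ?L (?D k)" by simp
    show "continuous_map (subtopology ?L (?D k)) ?GI (\<lambda>z. proj_class (normalized_seminorm bs k z))"
      using continuous_normalized_seminorm[OF data bs k]
      by (rule continuous_map_from_subtopology_mono) blast
  next
    fix z assume "z \<in> topspace ?L"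
    then obtain k where k: "k < length bs" "z \<in> ?D k" using cover by blast
    show "\<exists>k. k \<in> {..<length bs} \<and> z \<in> ?D k \<and> g z = proj_class (normalized_seminorm bs k z)"
      using k g[OF k] by (intro exI[of _ k] conjI) simp_all
  next
    fix i j z assume "i \<in> {..<length bs}" "j \<in> {..<length bs}" "z \<in> topspace ?L \<inter> ?D i \<inter> ?D j"
    then show "proj_class (normalized_seminorm bs i z) = proj_class (normalized_seminorm bs j z)"
      using g[of i z] g[of j z] by simp
  qed
  moreover have "g (canonical_map \<xi>) = \<xi>" if xi: "\<xi> \<in> topspace ?GI" for \<xi>
  proof -
    obtain k where k: "k < length bs" "canonical_map \<xi> \<in> ?D k"
      "proj_class (normalized_seminorm bs k (canonical_map \<xi>)) = \<xi>"
      using left[OF xi] by blast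
    then show ?thesis using g[OF k(1,2)] by (simp only:)
  qed
  moreover have "canonical_map (g z) = z" if z: "z \<in> topspace ?L" for z
  proof -
    obtain k where k: "k < length bs" "z \<in> ?D k" using cover[OF z] by blast
    then show ?thesis using g[OF k] right(2)[OF k] by (simp only:)
  qed
  ultimately have "homeomorphic_maps ?GI ?L canonical_map g"
    unfolding homeomorphic_maps_def using continuous_canonical_map[OF data] by blast
  then show ?thesis by (rule homeomorphic_maps_imp_map)
qed

end
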